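(* Let $X_1,X_2,\ldots$ be independent identically distributed random variables with $\mathsf{E}X_1=0$ and $0<\mathsf{E}X_1^2=\sigma^2<\infty$ ($\sigma>0$). Let $p_j\in(0,1]$, $j\in\mathbb{N}$, be arbitrary. For $n\in\mathbb{N}$ let $\theta_n=p_1+\ldots+p_n$ and let $N_{n,\boldsymbol{p}_n}$ have the Poisson-binomial distribution with parameters $n$ and $\boldsymbol{p}_n=(p_1,\ldots,p_n)$, with $N_{n,\boldsymbol{p}_n},X_1,X_2,\ldots$ jointly independent. Let $S_{N_{n,\boldsymbol{p}_n}}=X_1+\ldots+X_{N_{n,\boldsymbol{p}_n}}$ (equal to $0$ if $N_{n,\boldsymbol{p}_n}=0$). Then for any $n\in\mathbb{N}$ $$\sup_{z\ge 0}\Big|Q_{S_{N_{n,\boldsymbol{p}_n}}}(z)-\Phi_0\Big(\frac{z}{2\sigma\sqrt{\theta_n}}\Big)\Big|\le\frac{7.4508}{\sigma^2}\,\mathsf{E}X_1^2\min\bigg\{1,\,\frac{|X_1|}{\sigma\sqrt{\theta_n}}\bigg\}.$$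
   Context: The concentration function of a random variable $\xi$ is $Q_\xi(z)=\sup_{x\in\mathbb{R}}\mathsf{P}(x\le\xi\le x+z)$, $z\ge 0$. $\Phi$ is the standard normal distribution function, and the folded normal distribution function is $\Phi_0(x)=2\Phi(x)-1$ for $x\ge 0$, $\Phi_0(x)=0$ for $x<0$. The Poisson-binomial distribution with parameters $n$ and $(p_1,\ldots,p_n)$ is the distribution of $\xi_1+\ldots+\xi_n$, where $\xi_1,\ldots,\xi_n$ are independent, $\mathsf{P}(\xi_j=1)=p_j$ and $\mathsf{P}(\xi_j=0)=1-p_j$. *)

theory Defs
  imports "HOL-Probability.Probability"
begin

text \<open>The supremum is over a nonempty set of reals contained in the unit interval whenever
  \<^term>\<open>M\<close> is a probability space.\<close>

definition concentration_function :: "'a measure \<Rightarrow> ('a \<Rightarrow> real) \<Rightarrow> real \<Rightarrow> real" where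
  "concentration_function M \<xi> z = (SUP x. measure M {\<omega> \<in> space M. x \<le> \<xi> \<omega> \<and> \<xi> \<omega> \<le> x + z})"

definition folded_normal_cdf :: "real \<Rightarrow> real" where
  "folded_normal_cdf x = (if x \<ge> 0 then 2 * cdf std_normal_distribution x - 1 else 0)"

text \<open>The product pmf makes the Boolean coordinates independent; a coordinate that is
  \<^const>\<open>True\<close> counts as the value 1 of the corresponding indicator.\<close>

definition poisson_binomial_pmf :: "nat \<Rightarrow> (nat \<Rightarrow> real) \<Rightarrow> nat pmf" where
  "poisson_binomial_pmf n p =
     map_pmf (\<lambda>\<xi>. \<Sum>j = 1..n. of_bool (\<xi> j)) (Pi_pmf {1..n} False (\<lambda>j. bernoulli_pmf (p j)))"

text \<open>Joint independence of a counting variable and a sequence indexed by the positive integers.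
  Since \<^const>\<open>prob_space.indep_vars\<close> needs a single value type, the counting variable is
  regarded as real-valued and placed at the index 0, so \<^term>\<open>X 0\<close> is ignored.\<close>

definition jointly_indep :: "'a measure \<Rightarrow> ('a \<Rightarrow> nat) \<Rightarrow> (nat \<Rightarrow> 'a \<Rightarrow> real) \<Rightarrow> bool" where
  "jointly_indep M N X \<longleftrightarrow>
     prob_space.indep_vars M (\<lambda>_. borel)
       (\<lambda>j. if j = 0 then (\<lambda>\<omega>. real (N \<omega>)) else X j) UNIV"

definition random_sum :: "(nat \<Rightarrow> 'a \<Rightarrow> real) \<Rightarrow> ('a \<Rightarrow> nat) \<Rightarrow> 'a \<Rightarrow> real" where
  "random_sum X N \<omega> = (\<Sum>j = 1..N \<omega>. X j \<omega>)"

end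

theory Submission
  imports Defs
begin

text \<open>
  Write \<open>W = S_N / (\<sigma> \<surd>\<theta>)\<close>, let \<open>Z\<close> be standard normal and let \<open>L\<close> be the right-hand side without the
  factor 7.4508. If \<open>L > 1/7\<close> there is nothing to prove. Otherwise \<open>1/\<surd>\<theta> \<le> L\<close>, which makes a second-order
  expansion of the characteristic function of a single summand effective for all \<open>0 \<le> t \<le> 1/L\<close>; the
  product formula for the characteristic function of a Poisson-binomial random sum then gives
  \<open>\<bar>E exp(itW) - exp(-t\<^sup>2/2)\<bar> \<le> L t\<^sup>2 exp(-t\<^sup>2/4)\<close> on that range. Smoothing with the Fejer kernel of
  bandwidth \<open>1/L\<close>, as in Esseen's inequality but applied directly to closed intervals, turns this into
  \<open>\<bar>P(W \<in> I) - P(Z \<in> I)\<bar> \<le> 7 L\<close> for every interval \<open>I\<close>. Finally, among the intervals of a given length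
  the one centred at the origin has the largest normal probability.
\<close>

section \<open>Fourier analysis of the Fejer kernel\<close>

text \<open>The Fejer kernel \<open>(1 - cos v) / (pi * v^2)\<close>, a probability density whose
  Fourier transform is the triangle \<open>1 - |t|\<close> on [-1, 1]. The form with
  \<open>sinc\<close> has its continuous value at 0 built in.\<close>

definition fejer :: "real \<Rightarrow> real" where
  "fejer v = (sinc (v / 2))\<^sup>2 / (2 * pi)"

lemma fejer_nonneg: "0 \<le> fejer v"
  by (simp add: fejer_def)

lemma fejer_minus [simp]: "fejer (- v) = fejer v"
  using sinc_neg[of "v / 2"] by (simp add: fejer_def)

lemma continuous_on_fejer: "continuous_on S fejer"
  unfolding fejer_def[abs_def] by (intro continuous_intros) auto

lemma isCont_fejer: "isCont fejer v"
  using continuous_on_fejer[of UNIV] by (simp add: continuous_on_eq_continuous_at)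

lemma borel_measurable_fejer [measurable]: "fejer \<in> borel_measurable borel"
  by (intro borel_measurable_continuous_onI continuous_on_fejer)

lemma fejer_eq:
  assumes "v \<noteq> 0"
  shows "fejer v = (1 - cos v) / (pi * v\<^sup>2)"
proof -
  have "1 - cos v = 2 * (sin (v / 2))\<^sup>2"
    using cos_double_sin[of "v / 2"] by simp
  then show ?thesis
    using assms by (simp add: fejer_def field_simps power2_eq_square)
qed

section \<open>Total mass of the Fejer kernel\<close>

lemma Si_0: "Si 0 = 0"
  using Si_neg[of 0] by simp

text \<open>Integrating \<open>(1 - cos v) / (pi * v^2)\<close> by parts leaves the sine integral
  and the boundary term \<open>(1 - cos x) / (pi * x)\<close>, which is \<open>x * fejer x\<close>.
  The latter form also makes sense at 0, where its difference quotient is \<open>fejer\<close>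
  itself and continuity suffices.\<close>

lemma DERIV_fejer_primitive:
  "((\<lambda>x. Si x / pi - x * fejer x) has_real_derivative fejer x) (at x)"
proof (cases "x = 0")
  case True
  have "(\<lambda>h. (h * fejer h) / h) \<midarrow>0\<rightarrow> fejer 0"
    using isCont_fejer[of 0] unfolding isCont_def
    by (rule Lim_transform_eventually) (auto simp: eventually_at_filter)
  then have "((\<lambda>x. x * fejer x) has_real_derivative fejer 0) (at 0)"
    by (simp add: DERIV_def)
  then have "((\<lambda>x. Si x / pi - x * fejer x) has_real_derivative (sinc 0 / pi - fejer 0)) (at 0)"
    by (intro DERIV_diff DERIV_cdivide DERIV_Si)
  then show ?thesis
    using True by (simp add: fejer_def)
next
  case False
  have "((\<lambda>x. Si x / pi - (1 - cos x) / (pi * x)) has_real_derivative fejer x) (at x)"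
  proof (rule DERIV_cong)
    show "((\<lambda>x. Si x / pi - (1 - cos x) / (pi * x)) has_real_derivative
        (sinc x / pi - (sin x * (pi * x) - (1 - cos x) * pi) / (pi * x * (pi * x)))) (at x)"
      using False
      by (intro DERIV_diff DERIV_cdivide DERIV_Si DERIV_divide) (auto intro!: derivative_eq_intros)
    show "sinc x / pi - (sin x * (pi * x) - (1 - cos x) * pi) / (pi * x * (pi * x)) = fejer x"
      using False by (simp add: fejer_eq divide_simps power2_eq_square)
  qed
  then show ?thesis
  proof (rule has_field_derivative_transform_within_open[where S = "- {0}"])
    fix y :: real assume "y \<in> - {0}"
    then show "Si y / pi - (1 - cos y) / (pi * y) = Si y / pi - y * fejer y"
      by (simp add: fejer_eq power2_eq_square)
  qed (use False in auto)
qed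

lemma tendsto_fejer_primitive:
  "((\<lambda>x. Si x / pi - x * fejer x) \<longlongrightarrow> 1 / 2) at_top"
proof -
  have "((\<lambda>x. x * fejer x) \<longlongrightarrow> 0) at_top"
  proof (rule Lim_null_comparison)
    show "\<forall>\<^sub>F x in at_top. norm (x * fejer x) \<le> 2 / pi / x"
      using eventually_gt_at_top[of 0]
    proof eventually_elim
      case (elim x)
      have "norm (x * fejer x) = (1 - cos x) / (pi * x)"
        using elim by (simp add: fejer_eq power2_eq_square abs_mult)
      also have "\<dots> \<le> 2 / (pi * x)"
        using elim cos_ge_minus_one[of x] by (intro divide_right_mono) auto
      finally show ?case by simp
    qed
    show "((\<lambda>x. 2 / pi / x) \<longlongrightarrow> 0) at_top"
      by (intro tendsto_divide_0[OF tendsto_const] filterlim_at_top_imp_at_infinity filterlim_ident)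
  qed
  with Si_at_top have "((\<lambda>x. Si x / pi - x * fejer x) \<longlongrightarrow> (pi / 2) / pi - 0) at_top"
    by (intro tendsto_intros) auto
  then show ?thesis by simp
qed

text \<open>The primitive gives mass 1/2 to the right half-line, reflection gives the same to the
  left one, and the two share only the null set {0}.\<close>

lemma has_bochner_integral_fejer: "has_bochner_integral lborel fejer 1"
proof (rule has_bochner_integral_nn_integral)
  have half: "(\<integral>\<^sup>+x. ennreal (fejer x) * indicator {0..} x \<partial>lborel) = ennreal (1 / 2)"
    by (subst nn_integral_FTC_atLeast[where F = "\<lambda>x. Si x / pi - x * fejer x" and T = "1 / 2"])
       (simp_all add: DERIV_fejer_primitive fejer_nonneg tendsto_fejer_primitive Si_0)
  have half': "(\<integral>\<^sup>+x. ennreal (fejer x) * indicator {..0} x \<partial>lborel) = ennreal (1 / 2)"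
    using half
    by (subst nn_integral_real_affine[where c = "-1" and t = 0])
       (auto simp: indicator_def intro!: nn_integral_cong)
  have "(\<integral>\<^sup>+x. ennreal (fejer x) \<partial>lborel)
      = (\<integral>\<^sup>+x. ennreal (fejer x) * indicator {0..} x + ennreal (fejer x) * indicator {..0} x \<partial>lborel)"
    using AE_lborel_singleton[of 0] by (intro nn_integral_cong_AE) (auto split: split_indicator)
  also have "\<dots> = ennreal (1 / 2) + ennreal (1 / 2)"
    by (subst nn_integral_add) (auto simp: half half')
  also have "\<dots> = ennreal (1/2 + 1/2)"
    by (subst ennreal_plus) auto
  finally show "(\<integral>\<^sup>+x. ennreal (fejer x) \<partial>lborel) = ennreal 1"
    by simp
qed (auto simp: fejer_nonneg)

text \<open>Real part of the third-order Taylor estimate of \<open>iexp\<close>: the odd terms are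
  imaginary and drop out. It serves to bound \<open>fejer\<close> below by a polynomial that can be
  integrated exactly.\<close>

lemma cos_le_quartic: "cos x \<le> 1 - x\<^sup>2 / 2 + x ^ 4 / 24" for x :: real
proof -
  have "Re (iexp x - (\<Sum>k\<le>3. (\<i> * x) ^ k / fact k)) \<le> x ^ 4 / 24"
    using order_trans[OF complex_Re_le_cmod iexp_approx1[of x 3]]
    by (simp add: eval_nat_numeral)
  moreover have "Re (\<Sum>k\<le>3. (\<i> * x) ^ k / fact k) = 1 - x\<^sup>2 / 2"
    by (simp add: eval_nat_numeral Re_divide Im_divide)
  ultimately show ?thesis
    by (simp add: Re_exp)
qed

lemma fejer_ge: "(1 / 2 - v\<^sup>2 / 24) / pi \<le> fejer v"
proof (cases "v = 0")
  case False
  have "v\<^sup>2 * (1 / 2 - v\<^sup>2 / 24) \<le> 1 - cos v"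
    using cos_le_quartic[of v] by (simp add: algebra_simps eval_nat_numeral)
  then have "1 / 2 - v\<^sup>2 / 24 \<le> (1 - cos v) / v\<^sup>2"
    using False by (simp add: pos_le_divide_eq mult.commute)
  from divide_right_mono[OF this, of pi] show ?thesis
    using False by (simp add: fejer_eq mult.commute)
qed (simp add: fejer_def)

text \<open>What matters is that \<open>9 / (4 * pi)\<close>, about 0.716, exceeds 1/2: the
  smoothing inequality divides by a quantity proportional to twice this mass minus 1.\<close>

lemma fejer_central_mass: "9 / (4 * pi) \<le> (LINT v:{-3..3}|lborel. fejer v)"
proof -
  have "(LINT v:{-3..3}|lborel. (1 / 2 - v\<^sup>2 / 24) / pi)
      = (3 / 2 - 3 ^ 3 / 72) / pi - ((-3) / 2 - (-3) ^ 3 / 72) / pi"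
    unfolding set_lebesgue_integral_def
    by (rule integral_FTC_atLeastAtMost[where F = "\<lambda>v. (v / 2 - v ^ 3 / 72) / pi"])
       (auto intro!: derivative_eq_intros continuous_intros
          simp: has_real_derivative_iff_has_vector_derivative[symmetric] field_simps power2_eq_square)
  also have "\<dots> = 9 / (4 * pi)"
    by (simp add: field_simps)
  finally have eq: "9 / (4 * pi) = (LINT v:{-3..3}|lborel. (1 / 2 - v\<^sup>2 / 24) / pi)" ..
  show ?thesis
    unfolding eq
    by (intro set_integral_mono borel_integrable_atLeastAtMost' continuous_intros
          continuous_on_fejer fejer_ge) auto
qed

text \<open>Integration by parts against the triangle. The primitive divides by \<open>v\<close>;
  the excluded point is a null set when the identity is integrated over \<open>v\<close>.\<close>

lemma fejer_fourier:
  assumes "v \<noteq> 0"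
  shows "(LINT t:{0..1}|lborel. (1 - t) * cos (t * v)) = pi * fejer v"
proof -
  have "(LINT t:{0..1}|lborel. (1 - t) * cos (t * v))
      = ((1 - 1) * sin (1 * v) / v - cos (1 * v) / v\<^sup>2) - ((1 - 0) * sin (0 * v) / v - cos (0 * v) / v\<^sup>2)"
    unfolding set_lebesgue_integral_def
    by (rule integral_FTC_atLeastAtMost[where F = "\<lambda>t. (1 - t) * sin (t * v) / v - cos (t * v) / v\<^sup>2"])
       (use assms in \<open>auto intro!: derivative_eq_intros continuous_intros
          simp: has_real_derivative_iff_has_vector_derivative[symmetric] field_simps power2_eq_square\<close>)
  also have "\<dots> = pi * fejer v"
    using assms by (simp add: fejer_eq field_simps)
  finally show ?thesis .
qed

lemma abs_sin_diff_le: "\<bar>sin x - sin y\<bar> \<le> \<bar>x - y\<bar>" for x y :: real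
proof -
  have "\<bar>sin x - sin y\<bar> = 2 * \<bar>sin ((x - y) / 2)\<bar> * \<bar>cos ((x + y) / 2)\<bar>"
    by (simp add: sin_diff_sin abs_mult)
  also have "\<dots> \<le> 2 * \<bar>(x - y) / 2\<bar> * 1"
    by (intro mult_mono abs_sin_x_le_abs_x) auto
  finally show ?thesis by simp
qed

text \<open>Integrate \<open>fejer_fourier\<close> over \<open>v\<close> and swap the integrals; the
  integrand is bounded on the rectangle [a, b] x [0, 1]. The inner integral of the cosine is the
  sine quotient.\<close>

lemma fejer_interval:
  assumes "a \<le> b"
  shows "(LINT v:{a..b}|lborel. fejer v) =
    (LINT t:{0..1}|lborel. (1 - t) * ((sin (t * b) - sin (t * a)) / t)) / pi"
proof -
  let ?f = "\<lambda>v t. indicator {a..b} v * (indicator {0..1} t * ((1 - t) * cos (t * v))) :: real"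
  have int: "integrable (lborel \<Otimes>\<^sub>M lborel) (case_prod ?f)"
  proof (rule integrableI_bounded_set[where B = 1 and A = "{a..b} \<times> {0..1}"])
    show "emeasure (lborel \<Otimes>\<^sub>M lborel) ({a..b} \<times> {0..1::real}) < \<infinity>"
      using assms by (subst lborel.emeasure_pair_measure_Times) (auto simp: ennreal_mult_less_top)
    have "\<bar>(1 - t) * cos (t * v)\<bar> \<le> 1" if "t \<in> {0..1}" for t v :: real
      using that mult_mono[of "\<bar>1 - t\<bar>" 1 "\<bar>cos (t * v)\<bar>" 1] by (simp add: abs_mult)
    then show "AE x\<in>{a..b} \<times> {0..1} in lborel \<Otimes>\<^sub>M lborel. norm (case_prod ?f x) \<le> 1"
      by (intro AE_I2) (auto split: split_indicator)
  qed (auto simp: indicator_def intro!: AE_I2)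
  have "pi * (LINT v:{a..b}|lborel. fejer v) = (LINT v:{a..b}|lborel. pi * fejer v)"
    by simp
  also have "\<dots> = (LINT v|lborel. LINT t|lborel. ?f v t)"
    unfolding set_lebesgue_integral_def
  proof (rule integral_cong_AE)
    show "AE v in lborel. indicator {a..b} v *\<^sub>R (pi * fejer v) = (LINT t|lborel. ?f v t)"
      using AE_lborel_singleton[of 0]
    proof eventually_elim
      case (elim v)
      then show ?case
        using fejer_fourier[of v] by (simp add: set_lebesgue_integral_def)
    qed
  qed measurable
  also have "\<dots> = (LINT t|lborel. LINT v|lborel. ?f v t)"
    using lborel_pair.Fubini_integral[OF int] by simp
  also have "\<dots> = (LINT t:{0..1}|lborel. (1 - t) * ((sin (t * b) - sin (t * a)) / t))"
    unfolding set_lebesgue_integral_def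
  proof (rule integral_cong_AE)
    show "AE t in lborel. (LINT v|lborel. ?f v t) =
        indicator {0..1} t *\<^sub>R ((1 - t) * ((sin (t * b) - sin (t * a)) / t))"
      using AE_lborel_singleton[of 0]
    proof eventually_elim
      case (elim t)
      have "(LINT v:{a..b}|lborel. cos (t * v)) = sin (t * b) / t - sin (t * a) / t"
        unfolding set_lebesgue_integral_def
        by (rule integral_FTC_atLeastAtMost)
           (use elim assms in \<open>auto intro!: derivative_eq_intros continuous_intros
              simp: has_real_derivative_iff_has_vector_derivative[symmetric]\<close>)
      moreover have "(LINT v|lborel. ?f v t)
          = (LINT v|lborel. (indicator {0..1} t * (1 - t)) * (indicator {a..b} v *\<^sub>R cos (t * v)))"
        by (rule Bochner_Integration.integral_cong) simp_all
      ultimately show ?case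
        by (simp add: diff_divide_distrib set_lebesgue_integral_def)
    qed
  qed measurable
  finally show ?thesis
    by (simp add: field_simps)
qed

text \<open>For nonzero \<open>t\<close> this is the integral of \<open>iexp (- (t * v))\<close>
  over \<open>v\<close> in [a, b]. At \<open>t = 0\<close> division by zero yields 0 instead of
  \<open>b - a\<close>, a single point that integrals over \<open>t\<close> do not see.\<close>

definition interval_fourier :: "real \<Rightarrow> real \<Rightarrow> real \<Rightarrow> complex" where
  "interval_fourier a b t = (iexp (- (t * a)) - iexp (- (t * b))) / (\<i> * t)"

lemma interval_fourier_measurable [measurable]: "interval_fourier a b \<in> borel_measurable borel"
  unfolding interval_fourier_def[abs_def] by measurable

text \<open>Free of \<open>a\<close> and \<open>b\<close>: this makes the later smoothing estimate
  uniform over all intervals.\<close>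

lemma norm_interval_fourier_le:
  assumes "t > 0"
  shows "cmod (interval_fourier a b t) \<le> 2 / t"
proof -
  have "cmod (iexp (- (t * a)) - iexp (- (t * b))) \<le> 1 + 1"
    by (rule order_trans[OF norm_triangle_ineq4]) (simp del: of_real_mult of_real_minus)
  then show ?thesis
    using assms by (simp add: interval_fourier_def norm_divide norm_mult divide_right_mono)
qed

section \<open>Smoothed interval probabilities in terms of characteristic functions\<close>

context real_distribution
begin

lemma integral_sin_diff_eq_char:
  assumes "t \<noteq> 0"
  shows "(LINT w|M. (sin (t * (b - w)) - sin (t * (a - w))) / t) = Re (char M t * interval_fourier a b t)"
proof -
  have int: "integrable M (\<lambda>w. iexp (t * w))"
    by (intro integrable_const_bound[where B = 1]) auto
  have Re: "Re (iexp (t * w) * interval_fourier a b t) = (sin (t * (b - w)) - sin (t * (a - w))) / t" for w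
  proof -
    have "iexp (t * w) * interval_fourier a b t = (iexp (t * (w - a)) - iexp (t * (w - b))) / (\<i> * t)"
      by (simp add: interval_fourier_def algebra_simps exp_add[symmetric])
    also have "Re \<dots> = (sin (t * (w - a)) - sin (t * (w - b))) / t"
      using assms by (simp add: Re_divide Im_exp Re_exp power2_eq_square)
    also have "\<dots> = (sin (t * (b - w)) - sin (t * (a - w))) / t"
      using sin_minus[of "t * (a - w)"] sin_minus[of "t * (b - w)"] by (simp add: algebra_simps)
    finally show ?thesis .
  qed
  have "char M t * interval_fourier a b t = (CLINT w|M. iexp (t * w) * interval_fourier a b t)"
    using int by (simp add: char_def)
  also have "Re \<dots> = (LINT w|M. Re (iexp (t * w) * interval_fourier a b t))"
    using int by (intro integral_Re[symmetric]) auto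
  also have "\<dots> = (LINT w|M. (sin (t * (b - w)) - sin (t * (a - w))) / t)"
    by (simp only: Re)
  finally show ?thesis ..
qed

lemma LINT_indicator_shift: "(LINT w|M. indicator {a..b} (v + w)) = prob {a - v..b - v}"
proof -
  have "(\<lambda>w. indicator {a..b} (v + w) :: real) = indicator {a - v..b - v}"
    by (auto simp: indicator_def fun_eq_iff)
  then show ?thesis by simp
qed

lemma measurable_prob_shift [measurable]: "(\<lambda>v. prob {a - v..b - v}) \<in> borel_measurable borel"
  unfolding LINT_indicator_shift[symmetric] by measurable

text \<open>The left side is the probability of [a, b] after adding independent noise with density
  \<open>fejer\<close>. By Parseval the noise multiplies the characteristic function by the
  triangle, so only frequencies up to 1 survive. Two applications of Fubini prove this directly,
  without inverting a transform.\<close>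

lemma fejer_smoothed_interval_eq_char:
  assumes "a \<le> b"
  shows "(LINT v|lborel. fejer v * prob {a - v..b - v}) =
    (LINT t:{0..1}|lborel. (1 - t) * Re (char M t * interval_fourier a b t)) / pi"
proof -
  interpret P: pair_sigma_finite lborel M ..
  let ?g = "\<lambda>t w. indicator {0..1} t * ((1 - t) * ((sin (t * (b - w)) - sin (t * (a - w))) / t)) :: real"
  let ?f = "\<lambda>v w. fejer v * indicator {a..b} (v + w) :: real"
  have int_ind: "integrable M (\<lambda>w. indicator {a..b} (v + w) :: real)" for v
    by (intro integrable_const_bound[where B = 1]) auto
  have int_f: "integrable (lborel \<Otimes>\<^sub>M M) (case_prod ?f)"
  proof (rule P.Fubini_integrable)
    show "integrable lborel (\<lambda>v. LINT w|M. norm (case_prod ?f (v, w)))"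
    proof (rule Bochner_Integration.integrable_bound)
      show "integrable lborel fejer"
        using has_bochner_integral_fejer by (rule integrable.intros)
      show "AE v in lborel. norm (LINT w|M. norm (case_prod ?f (v, w))) \<le> norm (fejer v)"
        by (auto simp: abs_mult fejer_nonneg LINT_indicator_shift mult_left_le)
    qed measurable
    show "AE v in lborel. integrable M (\<lambda>w. case_prod ?f (v, w))"
      using int_ind by auto
  qed measurable
  have int_g: "integrable (lborel \<Otimes>\<^sub>M M) (case_prod ?g)"
  proof (rule integrableI_bounded_set[where B = "b - a" and A = "{0..1::real} \<times> UNIV"])
    show "emeasure (lborel \<Otimes>\<^sub>M M) ({0..1::real} \<times> UNIV) < \<infinity>"
      using emeasure_space_1 by (subst emeasure_pair_measure_Times) auto
    have "norm (?g t w) \<le> b - a" for t w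
    proof (cases "t \<in> {0<..1}")
      case True
      \<comment> \<open>The Lipschitz bound of the sine cancels the singular factor
        \<open>1 / t\<close>, so the integrand is bounded uniformly in \<open>w\<close>.\<close>
      have "\<bar>sin (t * (b - w)) - sin (t * (a - w))\<bar> \<le> t * (b - a)"
        using abs_sin_diff_le[of "t * (b - w)" "t * (a - w)"] True assms
        by (simp add: algebra_simps abs_mult flip: right_diff_distrib)
      then have "\<bar>(sin (t * (b - w)) - sin (t * (a - w))) / t\<bar> \<le> b - a"
        using True by (simp add: field_simps)
      then have "\<bar>1 - t\<bar> * \<bar>(sin (t * (b - w)) - sin (t * (a - w))) / t\<bar> \<le> 1 * (b - a)"
        using True by (intro mult_mono) auto
      then show ?thesis
        using True by (simp add: abs_mult)
    qed (use assms in \<open>auto split: split_indicator\<close>)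
    then have "norm (case_prod ?g x) \<le> b - a" for x
      by (cases x) (simp only: prod.case)
    then show "AE x\<in>{0..1} \<times> UNIV in lborel \<Otimes>\<^sub>M M. norm (case_prod ?g x) \<le> b - a"
      by (intro AE_I2 impI)
  qed (auto simp: indicator_def intro!: AE_I2)
  have "(LINT v|lborel. fejer v * prob {a - v..b - v}) = (LINT v|lborel. LINT w|M. ?f v w)"
    by (simp add: LINT_indicator_shift)
  also have "\<dots> = (LINT w|M. LINT v|lborel. ?f v w)"
    using P.Fubini_integral[OF int_f] by simp
  also have "\<dots> = (LINT w|M. (LINT t|lborel. ?g t w) / pi)"
  proof (rule Bochner_Integration.integral_cong[OF refl])
    fix w
    have "(LINT v|lborel. ?f v w) = (LINT v:{a - w..b - w}|lborel. fejer v)"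
      unfolding set_lebesgue_integral_def
      by (intro Bochner_Integration.integral_cong) (auto simp: indicator_def)
    then show "(LINT v|lborel. ?f v w) = (LINT t|lborel. ?g t w) / pi"
      using fejer_interval[of "a - w" "b - w"] assms by (simp add: set_lebesgue_integral_def)
  qed
  also have "\<dots> = (LINT t|lborel. LINT w|M. ?g t w) / pi"
    using P.Fubini_integral[OF int_g] by simp
  also have "(LINT t|lborel. LINT w|M. ?g t w)
      = (LINT t:{0..1}|lborel. (1 - t) * Re (char M t * interval_fourier a b t))"
    unfolding set_lebesgue_integral_def
  proof (rule integral_cong_AE)
    show "AE t in lborel. (LINT w|M. ?g t w)
        = indicator {0..1} t *\<^sub>R ((1 - t) * Re (char M t * interval_fourier a b t))"
      using AE_lborel_singleton[of 0]
    proof eventually_elim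
      case (elim t)
      have "(LINT w|M. ?g t w)
          = indicator {0..1} t * ((1 - t) * (LINT w|M. (sin (t * (b - w)) - sin (t * (a - w))) / t))"
        by (simp only: integral_mult_right_zero)
      also have "\<dots> = indicator {0..1} t *\<^sub>R ((1 - t) * Re (char M t * interval_fourier a b t))"
        by (simp only: integral_sin_diff_eq_char[OF elim] real_scaleR_def)
      finally show ?case .
    qed
  qed measurable
  finally show ?thesis .
qed

end

section \<open>A smoothing inequality for interval probabilities\<close>

text \<open>Complements the bound \<open>2 / t\<close>, which is not integrable at 0; this one
  secures integrability for each fixed interval.\<close>

lemma norm_interval_fourier_le_length:
  assumes "a \<le> b"
  shows "cmod (interval_fourier a b t) \<le> b - a"
proof (cases "t = 0")
  case False
  then show ?thesis
    using Levy_Inversion_aux2[of "- b" "- a" t] assms by (simp add: interval_fourier_def)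
qed (use assms in \<open>simp add: interval_fourier_def\<close>)

lemma (in real_distribution) integrable_char_interval_fourier:
  assumes "a \<le> b"
  shows "set_integrable lborel {0..1} (\<lambda>t. (1 - t) * Re (char M t * interval_fourier a b t))"
  unfolding set_integrable_def
proof (rule integrableI_bounded_set_indicator[where B = "b - a"])
  have "\<bar>(1 - t) * Re (char M t * interval_fourier a b t)\<bar> \<le> b - a" if "t \<in> {0..1}" for t
  proof -
    have "\<bar>Re (char M t * interval_fourier a b t)\<bar> \<le> cmod (char M t) * cmod (interval_fourier a b t)"
      by (metis abs_Re_le_cmod norm_mult)
    also have "\<dots> \<le> 1 * (b - a)"
      by (intro mult_mono cmod_char_le_1 norm_interval_fourier_le_length assms) auto
    finally have "\<bar>1 - t\<bar> * \<bar>Re (char M t * interval_fourier a b t)\<bar> \<le> 1 * (b - a)"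
      using that by (intro mult_mono) auto
    then show ?thesis
      by (simp add: abs_mult)
  qed
  then show "AE t in lborel. t \<in> {0..1} \<longrightarrow> norm ((1 - t) * Re (char M t * interval_fourier a b t)) \<le> b - a"
    by auto
qed auto

text \<open>The factor \<open>t\<close> in the assumption on the characteristic functions cancels
  the \<open>2 / t\<close> bounding \<open>interval_fourier\<close>; the triangle
  \<open>1 - t\<close> is simply bounded by 1. The result does not depend on \<open>a\<close> and
  \<open>b\<close>.\<close>

lemma fejer_smoothed_diff_le:
  assumes \<mu>: "real_distribution \<mu>" and \<nu>: "real_distribution \<nu>" and "a \<le> b"
    and h: "set_integrable lborel {0..1} h" "\<And>t. 0 < t \<Longrightarrow> t \<le> 1 \<Longrightarrow> cmod (char \<mu> t - char \<nu> t) \<le> t * h t"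
  shows "\<bar>LINT v|lborel. fejer v * (measure \<mu> {a - v..b - v} - measure \<nu> {a - v..b - v})\<bar>
    \<le> 2 / pi * (LINT t:{0..1}|lborel. h t)"
proof -
  interpret \<mu>: real_distribution \<mu> by fact
  interpret \<nu>: real_distribution \<nu> by fact
  let ?c = "interval_fourier a b"
  have diff_eq: "(1 - t) * Re (char \<mu> t * ?c t) - (1 - t) * Re (char \<nu> t * ?c t)
      = (1 - t) * Re ((char \<mu> t - char \<nu> t) * ?c t)" for t
    by (simp add: algebra_simps)
  have int: "integrable lborel (\<lambda>v. fejer v * measure M {a - v..b - v})" if "real_distribution M" for M
  proof -
    interpret real_distribution M by fact
    show ?thesis
      using integrable.intros[OF has_bochner_integral_fejer]
      by (rule Bochner_Integration.integrable_bound) (auto simp: abs_mult fejer_nonneg mult_left_le)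
  qed
  have "(LINT v|lborel. fejer v * (measure \<mu> {a - v..b - v} - measure \<nu> {a - v..b - v}))
      = (LINT v|lborel. fejer v * measure \<mu> {a - v..b - v}) - (LINT v|lborel. fejer v * measure \<nu> {a - v..b - v})"
    using int[OF \<mu>] int[OF \<nu>] by (simp add: right_diff_distrib)
  also have "\<dots> = ((LINT t:{0..1}|lborel. (1 - t) * Re (char \<mu> t * ?c t))
      - (LINT t:{0..1}|lborel. (1 - t) * Re (char \<nu> t * ?c t))) / pi"
    using \<open>a \<le> b\<close>
    by (simp only: \<mu>.fejer_smoothed_interval_eq_char \<nu>.fejer_smoothed_interval_eq_char diff_divide_distrib)
  also have "\<dots> = (LINT t:{0..1}|lborel. (1 - t) * Re (char \<mu> t * ?c t) - (1 - t) * Re (char \<nu> t * ?c t)) / pi"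
    using \<mu>.integrable_char_interval_fourier[OF \<open>a \<le> b\<close>] \<nu>.integrable_char_interval_fourier[OF \<open>a \<le> b\<close>]
    by (simp only: set_integral_diff)
  also have "\<dots> = (LINT t:{0..1}|lborel. (1 - t) * Re ((char \<mu> t - char \<nu> t) * ?c t)) / pi"
    by (simp only: diff_eq)
  finally have eq: "(LINT v|lborel. fejer v * (measure \<mu> {a - v..b - v} - measure \<nu> {a - v..b - v}))
      = (LINT t:{0..1}|lborel. (1 - t) * Re ((char \<mu> t - char \<nu> t) * ?c t)) / pi" .
  have "\<bar>LINT t:{0..1}|lborel. (1 - t) * Re ((char \<mu> t - char \<nu> t) * ?c t)\<bar>
      \<le> (LINT t|lborel. 2 * (indicator {0..1} t *\<^sub>R h t))"
    unfolding set_lebesgue_integral_def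
  proof (rule order_trans[OF integral_abs_bound integral_mono_AE])
    have "set_integrable lborel {0..1} (\<lambda>t. (1 - t) * Re ((char \<mu> t - char \<nu> t) * ?c t))"
      using set_integral_diff(1)[OF \<mu>.integrable_char_interval_fourier[OF \<open>a \<le> b\<close>]
          \<nu>.integrable_char_interval_fourier[OF \<open>a \<le> b\<close>]]
      by (simp only: diff_eq)
    then show "integrable lborel (\<lambda>t. \<bar>indicator {0..1} t *\<^sub>R ((1 - t) * Re ((char \<mu> t - char \<nu> t) * ?c t))\<bar>)"
      unfolding set_integrable_def by (rule integrable_abs)
    show "integrable lborel (\<lambda>t. 2 * (indicator {0..1} t *\<^sub>R h t))"
      using h(1) by (simp add: set_integrable_def)
    show "AE t in lborel. \<bar>indicator {0..1} t *\<^sub>R ((1 - t) * Re ((char \<mu> t - char \<nu> t) * ?c t))\<bar>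
        \<le> 2 * (indicator {0..1} t *\<^sub>R h t)"
      using AE_lborel_singleton[of 0]
    proof eventually_elim
      case (elim t)
      show ?case
      proof (cases "t \<in> {0<..1}")
        case True
        have "\<bar>Re ((char \<mu> t - char \<nu> t) * ?c t)\<bar> \<le> cmod (char \<mu> t - char \<nu> t) * cmod (?c t)"
          by (metis abs_Re_le_cmod norm_mult)
        also have "\<dots> \<le> (t * h t) * (2 / t)"
          using True h(2)[of t] norm_interval_fourier_le[of t a b]
          by (intro mult_mono) (auto intro: order_trans[OF norm_ge_zero])
        also have "\<dots> = 2 * h t"
          using True by simp
        finally have "\<bar>1 - t\<bar> * \<bar>Re ((char \<mu> t - char \<nu> t) * ?c t)\<bar> \<le> 1 * (2 * h t)"
          using True by (intro mult_mono) auto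
        then show ?thesis
          using True by (simp add: abs_mult)
      qed (use elim in auto)
    qed
  qed
  then have "\<bar>LINT t:{0..1}|lborel. (1 - t) * Re ((char \<mu> t - char \<nu> t) * ?c t)\<bar> / pi
      \<le> 2 * (LINT t:{0..1}|lborel. h t) / pi"
    by (intro divide_right_mono) (auto simp: set_lebesgue_integral_def)
  then show ?thesis
    unfolding eq by (simp add: abs_divide)
qed

text \<open>Unsmoothing: moving each endpoint of an interval by 3 in the direction favourable to the
  sign of the discrepancy makes all shifts by at most 3 nested with the original interval.
  Monotonicity handles \<open>\<mu>\<close>, and the Lipschitz bound \<open>m\<close> handles
  \<open>\<nu>\<close> at a cost of \<open>6 * m\<close>. Solving the resulting inequality for the
  supremum \<open>D\<close> gives the constant.\<close>

lemma fejer_smoothing_inequality: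
  assumes "real_distribution \<mu>" "real_distribution \<nu>"
    and m: "0 \<le> m" "\<And>c d. c \<le> d \<Longrightarrow> measure \<nu> {c..d} \<le> m * (d - c)"
    and \<eta>: "\<And>a b. a \<le> b \<Longrightarrow>
      \<bar>LINT v|lborel. fejer v * (measure \<mu> {a - v..b - v} - measure \<nu> {a - v..b - v})\<bar> \<le> \<eta>"
  shows "\<bar>measure \<mu> {a..b} - measure \<nu> {a..b}\<bar> \<le> (4 * pi * \<eta> + 54 * m) / (18 - 4 * pi)"
proof -
  interpret \<mu>: real_distribution \<mu> by fact
  interpret \<nu>: real_distribution \<nu> by fact
  define d where "d a b = measure \<mu> {a..b} - measure \<nu> {a..b}" for a b
  \<comment> \<open>A finite supremum, since every discrepancy is at most 1; this is what permits
    moving \<open>D\<close> across an inequality at the end.\<close>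
  define D where "D = (SUP (a, b)\<in>UNIV. \<bar>d a b\<bar>)"
  define \<kappa> where "\<kappa> = (LINT v:{-3..3}|lborel. fejer v)"
  have d_le_1: "\<bar>d a b\<bar> \<le> 1" for a b
    using \<mu>.prob_le_1[of "{a..b}"] \<nu>.prob_le_1[of "{a..b}"] measure_nonneg[of \<mu> "{a..b}"]
      measure_nonneg[of \<nu> "{a..b}"] unfolding d_def by linarith
  have d_le_D: "\<bar>d a b\<bar> \<le> D" for a b
    unfolding D_def using d_le_1
    by (intro cSUP_upper2[of _ _ "(a, b)"]) (auto intro!: bdd_aboveI[where M = 1])
  have D_nonneg: "0 \<le> D"
    using d_le_D[of 0 0] by linarith
  have \<eta>_nonneg: "0 \<le> \<eta>"
    using \<eta>[of 0 0] by linarith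
  have d_measurable [measurable]: "(\<lambda>v. d (a - v) (b - v)) \<in> borel_measurable borel" for a b
    unfolding d_def by measurable
  have int_fejer: "integrable lborel fejer" and integral_fejer: "integral\<^sup>L lborel fejer = 1"
    using has_bochner_integral_fejer by (auto simp: has_bochner_integral_iff)
  have int_fejer3: "integrable lborel (\<lambda>v. fejer v * indicator {-3..3} v)"
    using int_fejer by (intro integrable_real_mult_indicator) auto
  have \<kappa>_eq: "(LINT v|lborel. fejer v * indicator {-3..3} v) = \<kappa>"
    by (simp add: \<kappa>_def set_lebesgue_integral_def mult.commute)
  have \<kappa>_le: "\<kappa> \<le> 1"
    unfolding \<kappa>_eq[symmetric] integral_fejer[symmetric]
    by (intro integral_mono int_fejer3 int_fejer) (auto simp: fejer_nonneg indicator_def)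
  have \<kappa>_ge: "9 / (4 * pi) \<le> \<kappa>"
    unfolding \<kappa>_def by (rule fejer_central_mass)
  have \<kappa>_pos: "0 < \<kappa>"
    using \<kappa>_ge pi_gt_zero by (smt (verit) divide_pos_pos)
  \<comment> \<open>The window \<open>[-3, 3]\<close> carries more than half of the Fejer mass, so the contribution of the tail,
    which is at worst \<open>-D\<close>, can be absorbed on the left-hand side.\<close>
  have smoothed: "\<kappa> * \<delta> - (1 - \<kappa>) * D \<le> \<eta>"
    if ab: "a \<le> b" and s: "s \<in> {-1, 1}" and \<delta>: "\<And>v. v \<in> {-3..3} \<Longrightarrow> \<delta> \<le> s * d (a - v) (b - v)"
    for a b s \<delta>
  proof -
    have int_d: "integrable lborel (\<lambda>v. fejer v * d (a - v) (b - v))"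
      using int_fejer by (rule Bochner_Integration.integrable_bound)
        (auto simp: abs_mult intro!: mult_left_le d_le_1)
    \<comment> \<open>Rewritten as a single integral so that the comparison can be made pointwise:
      at least \<open>\<delta>\<close> on the window, at least \<open>- D\<close> outside
      it.\<close>
    have "\<kappa> * \<delta> - (1 - \<kappa>) * D
        = (LINT v|lborel. (fejer v * indicator {-3..3} v) * (\<delta> + D) - fejer v * D)"
      using int_fejer int_fejer3 by (simp add: \<kappa>_eq integral_fejer algebra_simps)
    also have "\<dots> \<le> (LINT v|lborel. s * (fejer v * d (a - v) (b - v)))"
    proof (rule integral_mono)
      fix v
      have "- D \<le> s * d (a - v) (b - v)"
        using s d_le_D[of "a - v" "b - v"] by auto
      then have "indicator {-3..3} v * (\<delta> + D) - D \<le> s * d (a - v) (b - v)"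
        using \<delta>[of v] by (auto simp: indicator_def)
      from mult_left_mono[OF this fejer_nonneg[of v]]
      show "fejer v * indicator {-3..3} v * (\<delta> + D) - fejer v * D \<le> s * (fejer v * d (a - v) (b - v))"
        by (simp add: algebra_simps)
    qed (use int_d int_fejer int_fejer3 in auto)
    also have "\<dots> \<le> \<bar>LINT v|lborel. fejer v * d (a - v) (b - v)\<bar>"
      using s by auto
    also have "\<dots> \<le> \<eta>"
      using \<eta>[OF ab] by (simp add: d_def)
    finally show ?thesis .
  qed
  have \<nu>_shrink: "measure \<nu> {a..b} \<le> measure \<nu> {c..e} + m * ((c - a) + (b - e))"
    if "a \<le> c" "c \<le> e" "e \<le> b" for a b c e
  proof -
    have "{a..b} = {a..c} \<union> {c..e} \<union> {e..b}"
      using that by auto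
    then have "measure \<nu> {a..b} \<le> measure \<nu> {a..c} + measure \<nu> {c..e} + measure \<nu> {e..b}"
      using measure_Un_le[of "{a..c} \<union> {c..e}" \<nu> "{e..b}"] measure_Un_le[of "{a..c}" \<nu> "{c..e}"]
      by simp
    then show ?thesis
      using m(2)[of a c] m(2)[of e b] that by (simp add: algebra_simps)
  qed
  have key: "\<kappa> * (\<bar>d a b\<bar> - 6 * m) - (1 - \<kappa>) * D \<le> \<eta>" for a b
  proof (cases "\<bar>d a b\<bar> \<le> 6 * m")
    case True
    then have "\<kappa> * (\<bar>d a b\<bar> - 6 * m) \<le> 0" "0 \<le> (1 - \<kappa>) * D"
      using \<kappa>_pos \<kappa>_le D_nonneg by (auto intro: mult_nonneg_nonpos)
    then show ?thesis
      using \<eta>_nonneg by linarith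
  next
    case False
    \<comment> \<open>An empty interval has discrepancy 0, which the first case covers.\<close>
    then have "a \<le> b"
      using m(1) by (cases "a \<le> b") (auto simp: d_def)
    show ?thesis
    proof (cases "0 \<le> d a b")
      case True
      show ?thesis
      \<comment> \<open>Excess of \<open>\<mu>\<close>: after widening, every shift by
        \<open>v\<close> still contains [a, b], and the total added length is
        \<open>(3 + v) + (3 - v) = 6\<close>.\<close>
      proof (rule smoothed[of "a - 3" "b + 3" 1])
        fix v :: real assume v: "v \<in> {-3..3}"
        have "measure \<nu> {a - 3 - v..b + 3 - v} \<le> measure \<nu> {a..b} + m * 6"
          using \<nu>_shrink[of "a - 3 - v" a b "b + 3 - v"] v \<open>a \<le> b\<close> by (simp add: algebra_simps)
        moreover have "measure \<mu> {a..b} \<le> measure \<mu> {a - 3 - v..b + 3 - v}"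
          using v by (intro \<mu>.finite_measure_mono) auto
        ultimately show "\<bar>d a b\<bar> - 6 * m \<le> 1 * d (a - 3 - v) (b + 3 - v)"
          using True by (simp add: d_def)
      qed (use \<open>a \<le> b\<close> in auto)
    next
      case neg: False
      \<comment> \<open>Deficit of \<open>\<mu>\<close>: the interval must shrink instead. Its
        \<open>\<nu>\<close>-mass exceeds \<open>6 * m\<close>, which forces length at least 6, so
        that removing 3 at each end leaves an interval.\<close>
      have "6 * m < measure \<nu> {a..b}"
        using False neg measure_nonneg[of \<mu> "{a..b}"] unfolding d_def by linarith
      also have "\<dots> \<le> m * (b - a)"
        using \<open>a \<le> b\<close> by (rule m)
      finally have "m * 6 < m * (b - a)"
        by (simp add: mult.commute)
      then have len: "6 \<le> b - a"
        using m(1) by (auto simp: mult_less_cancel_left)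
      show ?thesis
      proof (rule smoothed[of "a + 3" "b - 3" "-1"])
        fix v :: real assume v: "v \<in> {-3..3}"
        have "measure \<nu> {a..b} \<le> measure \<nu> {a + 3 - v..b - 3 - v} + m * 6"
          using \<nu>_shrink[of a "a + 3 - v" "b - 3 - v" b] v len by (simp add: algebra_simps)
        moreover have "measure \<mu> {a + 3 - v..b - 3 - v} \<le> measure \<mu> {a..b}"
          using v by (intro \<mu>.finite_measure_mono) auto
        ultimately show "\<bar>d a b\<bar> - 6 * m \<le> - 1 * d (a + 3 - v) (b - 3 - v)"
          using neg by (simp add: d_def)
      qed (use len in auto)
    qed
  qed
  \<comment> \<open>The estimate \<open>key\<close> solved for the discrepancy; it is free of
    \<open>a\<close> and \<open>b\<close> and hence bounds \<open>D\<close>.\<close>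
  define C where "C = (\<eta> + 6 * m * \<kappa> + (1 - \<kappa>) * D) / \<kappa>"
  have "\<bar>d a b\<bar> \<le> C" for a b
    using key[of a b] \<kappa>_pos by (simp add: C_def pos_le_divide_eq algebra_simps)
  then have "D \<le> C"
    unfolding D_def by (intro cSUP_least) auto
  then have "\<kappa> * (2 * D - 6 * m) \<le> \<eta> + D"
    using \<kappa>_pos by (simp add: C_def pos_le_divide_eq algebra_simps)
  \<comment> \<open>Replacing \<open>\<kappa>\<close> by its lower bound is monotone only for a
    nonnegative factor; otherwise the left side is at most 0, hence the \<open>max\<close>.\<close>
  moreover have "9 / (4 * pi) * (2 * D - 6 * m) \<le> max 0 (\<kappa> * (2 * D - 6 * m))"
  proof (cases "0 \<le> 2 * D - 6 * m")
    case True
    from mult_right_mono[OF \<kappa>_ge this] show ?thesis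
      by linarith
  next
    case False
    then have "9 / (4 * pi) * (2 * D - 6 * m) \<le> 0"
      by (intro mult_nonneg_nonpos) auto
    then show ?thesis
      by linarith
  qed
  ultimately have "9 / (4 * pi) * (2 * D - 6 * m) \<le> \<eta> + D"
    using \<eta>_nonneg D_nonneg by linarith
  then have "9 * (2 * D - 6 * m) \<le> 4 * pi * (\<eta> + D)"
    by (simp add: field_simps)
  then have "D * (18 - 4 * pi) \<le> 4 * pi * \<eta> + 54 * m"
    by (simp add: algebra_simps)
  then have "D \<le> (4 * pi * \<eta> + 54 * m) / (18 - 4 * pi)"
    using pi_less_4 by (simp add: pos_le_divide_eq)
  then show ?thesis
    using d_le_D[of a b] unfolding d_def by linarith
qed

section \<open>Characteristic functions near the normal one\<close>

lemma abs_exp_minus_linear_le: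
  fixes u :: real
  assumes "0 \<le> u"
  shows "\<bar>(1 - u) - exp (- u)\<bar> \<le> u\<^sup>2 / 2"
proof -
  let ?g = "\<lambda>u::real. 1 - u + u\<^sup>2 / 2 - exp (- u)"
  have "?g 0 \<le> ?g u"
  proof (rule DERIV_nonneg_imp_nondecreasing[OF assms])
    fix x :: real
    have "(?g has_real_derivative (- 1 + x + exp (- x))) (at x)"
      by (auto intro!: derivative_eq_intros)
    moreover have "0 \<le> - 1 + x + exp (- x)"
      using exp_ge_add_one_self[of "- x"] by simp
    ultimately show "\<exists>y. (?g has_real_derivative y) (at x) \<and> 0 \<le> y"
      by blast
  qed
  then show ?thesis
    using exp_ge_add_one_self[of "- u"] by simp
qed

text \<open>Telescoping: factors are exchanged one at a time. Dividing each difference by its own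
  \<open>c j\<close> restores the missing factor, so the full product of bounds comes out in
  front.\<close>

lemma norm_prod_diff_le:
  fixes a b :: "'i \<Rightarrow> 'a :: {real_normed_field}"
  assumes "finite A" "\<And>j. j \<in> A \<Longrightarrow> 0 < c j"
    and "\<And>j. j \<in> A \<Longrightarrow> norm (a j) \<le> c j" "\<And>j. j \<in> A \<Longrightarrow> norm (b j) \<le> c j"
  shows "norm ((\<Prod>j\<in>A. a j) - (\<Prod>j\<in>A. b j)) \<le> (\<Prod>j\<in>A. c j) * (\<Sum>j\<in>A. norm (a j - b j) / c j)"
  using assms
proof (induction A rule: finite_induct)
  case (insert x F)
  let ?a = "\<Prod>j\<in>F. a j" and ?b = "\<Prod>j\<in>F. b j" and ?c = "\<Prod>j\<in>F. c j"
  have c_pos: "0 < c x" "0 < ?c"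
    using insert.prems by (auto intro!: prod_pos)
  have "norm ?a \<le> ?c"
    unfolding prod_norm[symmetric] using insert.prems by (intro prod_mono) auto
  moreover have "norm (?a - ?b) \<le> ?c * (\<Sum>j\<in>F. norm (a j - b j) / c j)"
    using insert by auto
  moreover have "norm (b x) \<le> c x"
    using insert.prems by auto
  ultimately have "norm (a x - b x) * norm ?a + norm (b x) * norm (?a - ?b)
      \<le> norm (a x - b x) * ?c + c x * (?c * (\<Sum>j\<in>F. norm (a j - b j) / c j))"
    using c_pos by (intro add_mono mult_mono) auto
  moreover have "a x * ?a - b x * ?b = (a x - b x) * ?a + b x * (?a - ?b)"
    by (simp add: algebra_simps)
  then have "norm (a x * ?a - b x * ?b) \<le> norm (a x - b x) * norm ?a + norm (b x) * norm (?a - ?b)"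
    by (metis norm_triangle_ineq norm_mult)
  ultimately show ?case
    using insert.hyps c_pos by (simp add: algebra_simps)
qed simp

text \<open>As a function of \<open>y^2\<close>, the left side is the tangent at \<open>u^2\<close>
  to the convex function \<open>|y|^3\<close>. Its slope \<open>3 * u / 2\<close> is at most 1 for
  \<open>u\<close> up to 2/3, which keeps it below \<open>y^2\<close> when \<open>|y| > 1\<close>.
  Expectations then involve only the second moment.\<close>

lemma truncated_cube_ge:
  fixes u y :: real
  assumes "0 \<le> u" "u \<le> 2 / 3"
  shows "u * (3 * y\<^sup>2 - u\<^sup>2) / 2 \<le> y\<^sup>2 * min 1 \<bar>y\<bar>"
proof (cases "\<bar>y\<bar> \<le> 1")
  case True
  have "0 \<le> (\<bar>y\<bar> - u)\<^sup>2 * (2 * \<bar>y\<bar> + u)"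
    using assms by simp
  also have "\<dots> = 2 * (\<bar>y\<bar>\<^sup>2 * \<bar>y\<bar>) - u * (3 * \<bar>y\<bar>\<^sup>2 - u\<^sup>2)"
    by (simp add: algebra_simps power2_eq_square del: power2_abs)
  finally show ?thesis
    using True by simp
next
  case False
  have "u * (3 * y\<^sup>2 - u\<^sup>2) \<le> u * (3 * y\<^sup>2)"
    using assms by (intro mult_left_mono) auto
  also have "\<dots> \<le> 2 / 3 * (3 * y\<^sup>2)"
    using assms by (intro mult_right_mono) auto
  finally show ?thesis
    using False by simp
qed

context prob_space
begin

lemma integrable_truncated_cube:
  fixes Y :: "'a \<Rightarrow> real"
  assumes [measurable]: "random_variable borel Y" and "integrable M (\<lambda>x. (Y x)\<^sup>2)"
  shows "integrable M (\<lambda>x. (Y x)\<^sup>2 * min 1 \<bar>Y x\<bar>)"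
  using assms(2) by (rule Bochner_Integration.integrable_bound) (auto simp: abs_mult intro!: mult_left_le)

text \<open>Taking expectations in \<open>truncated_cube_ge\<close> at \<open>u = s\<close> gives
  \<open>s^3 \<le> s^2 * L\<close>. Admissibility of this \<open>u\<close> is where the smallness of
  \<open>L\<close> enters.\<close>

lemma sd_le_truncated_ratio:
  fixes Y :: "'a \<Rightarrow> real"
  assumes [measurable]: "random_variable borel Y" and int: "integrable M (\<lambda>x. (Y x)\<^sup>2)"
    and "0 < s" and second: "expectation (\<lambda>x. (Y x)\<^sup>2) = s\<^sup>2"
    and trunc: "expectation (\<lambda>x. (Y x)\<^sup>2 * min 1 \<bar>Y x\<bar>) = s\<^sup>2 * L" and "L \<le> 1 / 7"
  shows "s \<le> L"
proof -
  have bound: "u * (3 * s\<^sup>2 - u\<^sup>2) / 2 \<le> s\<^sup>2 * L" if "0 \<le> u" "u \<le> 2 / 3" for u :: real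
  proof -
    have "expectation (\<lambda>x. u * (3 * (Y x)\<^sup>2 - u\<^sup>2) / 2) \<le> expectation (\<lambda>x. (Y x)\<^sup>2 * min 1 \<bar>Y x\<bar>)"
      using int integrable_truncated_cube[OF assms(1) int] that
      by (intro integral_mono truncated_cube_ge) auto
    then show ?thesis
      using int by (simp add: second trunc prob_space)
  qed
  show ?thesis
  proof (cases "s \<le> 2 / 3")
    case True
    with bound[of s] \<open>0 < s\<close> have "s\<^sup>2 * s \<le> s\<^sup>2 * L"
      by (simp add: power2_eq_square algebra_simps)
    then show ?thesis
      using \<open>0 < s\<close> by simp
  next
    case False
    \<comment> \<open>The bound at \<open>u = 2/3\<close> reads
      \<open>s^2 - 4/27 \<le> s^2 * L\<close>, and with \<open>L \<le> 1/7\<close> it contradicts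
      \<open>s^2 > 4/9\<close>.\<close>
    then have "(2 / 3)\<^sup>2 < s\<^sup>2"
      by (intro power_strict_mono) auto
    moreover have "s\<^sup>2 * L \<le> s\<^sup>2 * (1 / 7)"
      using assms(6) by (intro mult_left_mono) auto
    ultimately show ?thesis
      using bound[of "2 / 3"] by (simp add: power2_eq_square)
  qed
qed

text \<open>Each factor is compared with \<open>exp (- (p j * x))\<close>, whose product is exactly
  the normal characteristic function. The common majorants \<open>c j\<close> keep Gaussian decay in
  the product, weakened only by the expansion error \<open>r\<close>.\<close>

lemma char_product_normal_approx:
  fixes Y :: "'a \<Rightarrow> real" and p :: "'i \<Rightarrow> real"
  assumes Y [measurable]: "random_variable borel Y" and int: "integrable M (\<lambda>x. (Y x)\<^sup>2)"
    and mean: "expectation Y = 0" and second: "expectation (\<lambda>x. (Y x)\<^sup>2) = 1 / \<theta>"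
    and trunc: "expectation (\<lambda>x. (Y x)\<^sup>2 * min 1 \<bar>Y x\<bar>) = L / \<theta>"
    and A: "finite A" "\<And>j. j \<in> A \<Longrightarrow> 0 \<le> p j" "\<And>j. j \<in> A \<Longrightarrow> p j \<le> 1"
    and \<theta>: "\<theta> = (\<Sum>j\<in>A. p j)" "0 < \<theta>"
    and L: "0 < L" "L \<le> 1 / 7" and t: "0 \<le> t" "t \<le> 1 / L"
  shows "cmod ((\<Prod>j\<in>A. 1 - p j + p j * char (distr M borel Y) t) - complex_of_real (exp (- t\<^sup>2 / 2)))
    \<le> L * t\<^sup>2 * exp (- t\<^sup>2 / 4)"
proof -
  let ?f = "char (distr M borel Y) t"
  \<comment> \<open>\<open>m\<close> is the least factor with
    \<open>min 6 (t * |y|) \<le> 6 * m * min 1 |y|\<close> for all \<open>y\<close>. With it,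
    \<open>1 - x\<close> is the second-order expansion of \<open>?f\<close> and \<open>r\<close>
    bounds its error.\<close>
  define m where "m = max 1 (t / 6)"
  define x where "x = t\<^sup>2 / (2 * \<theta>)"
  define r where "r = t\<^sup>2 * m * (L / \<theta>)"
  define c where "c j = exp (- (p j * (x - r)))" for j
  have int1: "integrable M Y"
    using int by (rule square_integrable_imp_integrable[rotated]) simp
  have "1 / sqrt \<theta> \<le> L"
    using sd_le_truncated_ratio[OF Y int, of "1 / sqrt \<theta>" L] \<theta> L second trunc
    by (simp add: power_divide)
  then have "(1 / sqrt \<theta>)\<^sup>2 \<le> L\<^sup>2"
    using \<theta> by (intro power_mono) auto
  then have \<theta>_ge: "1 / \<theta> \<le> L\<^sup>2"
    using \<theta> by (simp add: power_divide)
  have tL: "t * L \<le> 1"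
    using t L by (simp add: field_simps)
  have "x \<le> t\<^sup>2 * L\<^sup>2 / 2"
    using mult_left_mono[OF \<theta>_ge, of "t\<^sup>2"] by (simp add: x_def)
  moreover have "t\<^sup>2 * L\<^sup>2 \<le> 1"
    using power_le_one[of "t * L" 2] tL t L by (simp add: power_mult_distrib)
  moreover have "0 \<le> x"
    using \<theta>(2) by (simp add: x_def)
  ultimately have x: "0 \<le> x" "x \<le> t\<^sup>2 * L\<^sup>2 / 2" "x \<le> 1"
    by linarith+
  have r: "0 \<le> r"
    using L \<theta> t by (simp add: r_def m_def)
  have "cmod (?f - (1 - t\<^sup>2 * (1 / \<theta>) / 2)) \<le> t\<^sup>2 / 6 * expectation (\<lambda>x. min (6 * (Y x)\<^sup>2) (\<bar>t\<bar> * \<bar>Y x\<bar> ^ 3))"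
    using int int1 mean second by (intro char_approx3'[OF Y]) auto
  also have "\<dots> \<le> t\<^sup>2 / 6 * expectation (\<lambda>x. 6 * m * ((Y x)\<^sup>2 * min 1 \<bar>Y x\<bar>))"
  proof (intro mult_left_mono integral_mono)
    show "integrable M (\<lambda>x. min (6 * (Y x)\<^sup>2) (\<bar>t\<bar> * \<bar>Y x\<bar> ^ 3))"
      by (rule Bochner_Integration.integrable_bound[OF integrable_mult_right[OF int, of 6]]) auto
    show "integrable M (\<lambda>x. 6 * m * ((Y x)\<^sup>2 * min 1 \<bar>Y x\<bar>))"
      by (intro integrable_mult_right integrable_truncated_cube Y int)
    fix \<omega>
    let ?y = "\<bar>Y \<omega>\<bar>"
    have "min 6 (t * ?y) \<le> 6 * m * min 1 ?y"
    proof (cases "?y \<le> 1")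
      case True
      have "t * ?y \<le> 6 * m * ?y"
        by (intro mult_right_mono) (auto simp: m_def)
      then show ?thesis
        using True by simp
    qed (auto simp: m_def)
    from mult_left_mono[OF this, of "?y\<^sup>2"]
    have "min (6 * ?y\<^sup>2) (t * ?y ^ 3) \<le> 6 * m * (?y\<^sup>2 * min 1 ?y)"
      by (simp add: mult_min_right power3_eq_cube power2_eq_square mult_ac del: power2_abs abs_mult_self_eq)
    then show "min (6 * (Y \<omega>)\<^sup>2) (\<bar>t\<bar> * ?y ^ 3) \<le> 6 * m * ((Y \<omega>)\<^sup>2 * min 1 ?y)"
      using t by simp
  qed auto
  also have "\<dots> = r"
    by (simp add: trunc r_def)
  finally have f: "cmod (?f - (1 - x)) \<le> r"
    by (simp add: x_def mult.commute)
  have c_pos: "0 < c j" for j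
    by (simp add: c_def)
  have factor: "1 - p j + p j * ?f = complex_of_real (1 - p j * x) + p j * (?f - (1 - x))" for j
    by (simp add: algebra_simps)
  \<comment> \<open>Ensures \<open>1 - p j * x\<close> is nonnegative, so that its modulus is
    itself.\<close>
  have px: "p j * x \<le> 1" if "j \<in> A" for j
    using A that x mult_mono[of "p j" 1 x 1] by auto
  have a_le: "cmod (1 - p j + p j * ?f) \<le> c j" if j: "j \<in> A" for j
  proof -
    have "cmod (1 - p j + p j * ?f) \<le> cmod (complex_of_real (1 - p j * x)) + cmod (p j * (?f - (1 - x)))"
      unfolding factor by (rule norm_triangle_ineq)
    also have "\<dots> \<le> (1 - p j * x) + p j * r"
      using px[OF j] A(2)[OF j] f by (auto simp: norm_mult simp del: of_real_diff intro!: mult_left_mono)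
    also have "\<dots> \<le> c j"
      using exp_ge_add_one_self[of "- (p j * (x - r))"] by (simp add: c_def algebra_simps)
    finally show ?thesis .
  qed
  have b_le: "cmod (exp (- (p j * x))) \<le> c j" if j: "j \<in> A" for j
    using A(2)[OF j] r by (simp add: c_def algebra_simps)
  \<comment> \<open>Two errors, from the expansion and from replacing \<open>1 - p j * x\<close> by
    an exponential; \<open>p j \<le> 1\<close> makes both linear in \<open>p j\<close>, so they sum
    to a multiple of \<open>\<theta>\<close>. Division by \<open>c j\<close> costs at most
    \<open>exp x\<close>.\<close>
  have diff: "cmod ((1 - p j + p j * ?f) - complex_of_real (exp (- (p j * x)))) / c j
      \<le> p j * (r + x\<^sup>2 / 2) * exp x" if j: "j \<in> A" for j
  proof -
    have "(1 - p j + p j * ?f) - complex_of_real (exp (- (p j * x)))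
        = p j * (?f - (1 - x)) + complex_of_real ((1 - p j * x) - exp (- (p j * x)))"
      by (simp add: algebra_simps)
    also have "cmod \<dots> \<le> cmod (p j * (?f - (1 - x))) + \<bar>(1 - p j * x) - exp (- (p j * x))\<bar>"
      by (metis norm_triangle_ineq norm_of_real)
    also have "\<dots> \<le> p j * r + (p j * x)\<^sup>2 / 2"
      using A(2)[OF j] f x
      by (intro add_mono abs_exp_minus_linear_le) (auto simp: norm_mult intro!: mult_left_mono)
    also have "p j * r + (p j * x)\<^sup>2 / 2 \<le> p j * r + p j * x\<^sup>2 / 2"
    proof -
      have "(p j)\<^sup>2 \<le> p j"
        using A(2,3)[OF j] by (simp add: power2_eq_square mult_left_le)
      then show ?thesis
        by (auto simp: power_mult_distrib intro!: mult_right_mono)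
    qed
    finally have num: "cmod ((1 - p j + p j * ?f) - complex_of_real (exp (- (p j * x)))) \<le> p j * (r + x\<^sup>2 / 2)"
      by (simp add: algebra_simps)
    have "p j * (x - r) \<le> p j * x"
      using A(2)[OF j] r by (intro mult_left_mono) auto
    also have "\<dots> \<le> x"
      using A(2,3)[OF j] x by (simp add: mult_left_le_one_le)
    finally have "inverse (c j) \<le> exp x"
      by (simp add: c_def exp_minus)
    with num show ?thesis
      unfolding divide_inverse using c_pos[of j] A(2)[OF j] r by (intro mult_mono) auto
  qed
  have prod_exp: "(\<Prod>j\<in>A. exp (- (p j * z))) = exp (- (\<theta> * z))" for z :: real
    by (simp add: \<theta>(1) sum_distrib_right exp_sum[OF A(1), symmetric] sum_negf)
  have \<theta>x: "\<theta> * x = t\<^sup>2 / 2"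
    using \<theta> by (simp add: x_def)
  have "cmod ((\<Prod>j\<in>A. 1 - p j + p j * ?f) - (\<Prod>j\<in>A. complex_of_real (exp (- (p j * x)))))
      \<le> (\<Prod>j\<in>A. c j) * (\<Sum>j\<in>A. cmod ((1 - p j + p j * ?f) - complex_of_real (exp (- (p j * x)))) / c j)"
    using A a_le b_le c_pos by (intro norm_prod_diff_le) auto
  also have "\<dots> \<le> (\<Prod>j\<in>A. c j) * (\<Sum>j\<in>A. p j * (r + x\<^sup>2 / 2) * exp x)"
    using c_pos by (intro mult_left_mono sum_mono diff prod_nonneg) (auto intro: less_imp_le)
  also have "\<dots> = exp (- (\<theta> * (x - r))) * (\<theta> * (r + x\<^sup>2 / 2) * exp x)"
    unfolding c_def prod_exp by (simp add: \<theta>(1) sum_distrib_right)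
  also have "\<dots> \<le> L * t\<^sup>2 * exp (- t\<^sup>2 / 4)"
  proof -
    \<comment> \<open>A quadratic majorant, from \<open>t / 6 \<le> 1 + t^2 / 144\<close>, ready to
      be absorbed into an exponential.\<close>
    have m_le: "m \<le> 1 + t\<^sup>2 / 144"
    proof -
      have "0 \<le> (t / 12 - 1)\<^sup>2"
        by simp
      then show ?thesis
        by (simp add: m_def power2_eq_square algebra_simps)
    qed
    \<comment> \<open>Here the range of \<open>t\<close> is used: \<open>L * t / 6\<close> is at
      most 1/6, and \<open>L\<close> itself is at most 1/7.\<close>
    have "L * m \<le> 1 / 6"
      using L tL by (auto simp: m_def max_def algebra_simps)
    from mult_left_mono[OF this, of "t\<^sup>2"]
    have \<theta>r_le: "\<theta> * r \<le> t\<^sup>2 / 6"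
      using \<theta> by (simp add: r_def algebra_simps)
    have L2: "L\<^sup>2 \<le> L * (1 / 7)"
      using L mult_left_mono[of L "1 / 7" L] by (simp add: power2_eq_square)
    have "\<theta> * (x\<^sup>2 / 2) = t\<^sup>2 / 4 * x"
      using \<theta>x by (simp add: power2_eq_square algebra_simps)
    also have "\<dots> \<le> t\<^sup>2 / 4 * (t\<^sup>2 * (L * (1 / 7)) / 2)"
      using x(2) mult_left_mono[OF L2, of "t\<^sup>2"] by (intro mult_left_mono) auto
    finally have "\<theta> * (r + x\<^sup>2 / 2) \<le> t\<^sup>2 * L * m + t\<^sup>2 * L * (t\<^sup>2 / 56)"
      using \<theta> by (simp add: r_def algebra_simps)
    also have "\<dots> = t\<^sup>2 * L * (m + t\<^sup>2 / 56)"
      by (simp add: algebra_simps)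
    also have "\<dots> \<le> t\<^sup>2 * L * exp (t\<^sup>2 / 36)"
    proof (rule mult_left_mono)
      \<comment> \<open>The coefficients fit because \<open>1/144 + 1/56 < 1/36\<close>.\<close>
      have "m + t\<^sup>2 / 56 \<le> 1 + t\<^sup>2 / 36"
        using m_le zero_le_power2[of t] by linarith
      also have "\<dots> \<le> exp (t\<^sup>2 / 36)"
        by (rule exp_ge_add_one_self)
      finally show "m + t\<^sup>2 / 56 \<le> exp (t\<^sup>2 / 36)" .
    qed (use L in simp)
    finally have "exp (- (\<theta> * (x - r))) * (\<theta> * (r + x\<^sup>2 / 2) * exp x)
        \<le> exp (- (\<theta> * (x - r))) * (t\<^sup>2 * L * exp (t\<^sup>2 / 36) * exp x)"
      by (intro mult_left_mono mult_right_mono) auto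
    also have "\<dots> = t\<^sup>2 * L * exp (- (\<theta> * (x - r)) + t\<^sup>2 / 36 + x)"
      by (simp only: exp_add mult_ac)
    also have "\<dots> \<le> t\<^sup>2 * L * exp (- t\<^sup>2 / 4)"
    proof -
      have "L\<^sup>2 \<le> 1 / 49"
        using L2 L by simp
      then have "x \<le> t\<^sup>2 / 98"
        using x(2) mult_left_mono[of "L\<^sup>2" "1 / 49" "t\<^sup>2"] by simp
      \<comment> \<open>The exponent budget: \<open>1/2 - 1/6 - 1/36 - 1/98\<close> is still above
        1/4.\<close>
      then have "- (\<theta> * (x - r)) + t\<^sup>2 / 36 + x \<le> - t\<^sup>2 / 4"
        using \<theta>x \<theta>r_le by (simp add: right_diff_distrib) (use zero_le_power2[of t] in linarith)
      then show ?thesis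
        using L by (intro mult_left_mono) auto
    qed
    finally show ?thesis
      by (simp add: mult.commute)
  qed
  also have "(\<Prod>j\<in>A. complex_of_real (exp (- (p j * x)))) = complex_of_real (exp (- t\<^sup>2 / 2))"
    unfolding of_real_prod[symmetric] prod_exp \<theta>x by simp
  finally show ?thesis .
qed

end

section \<open>Poisson-binomial random sums\<close>

lemma set_poisson_binomial_pmf: "set_pmf (poisson_binomial_pmf n p) \<subseteq> {..n}"
proof -
  have "(\<Sum>j = 1..n. of_bool (\<xi> j)) \<le> n" for \<xi> :: "nat \<Rightarrow> bool"
    using sum_bounded_above[of "{1..n}" "\<lambda>j. of_bool (\<xi> j) :: nat" 1] by auto
  then show ?thesis
    by (auto simp: poisson_binomial_pmf_def)
qed

text \<open>The probability generating function: \<open>z ^ k\<close> turns the sum of indicators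
  into a product of independent factors, each equal to 1 or \<open>z\<close>. It is needed at
  complex \<open>z\<close>, a value of a characteristic function.\<close>

lemma expectation_power_poisson_binomial:
  fixes z :: complex and p :: "nat \<Rightarrow> real"
  assumes p: "\<And>j. j \<in> {1..n} \<Longrightarrow> p j \<in> {0..1}"
  shows "measure_pmf.expectation (poisson_binomial_pmf n p) (\<lambda>k. z ^ k) = (\<Prod>j = 1..n. 1 - p j + p j * z)"
proof -
  let ?P = "Pi_pmf {1..n} False (\<lambda>j. bernoulli_pmf (p j))"
  have indep: "prob_space.indep_vars ?P (\<lambda>_. borel) (\<lambda>j \<xi>. z ^ of_bool (\<xi> j)) {1..n}"
    using indep_vars_Pi_pmf
    by (rule prob_space.indep_vars_compose2[OF measure_pmf.prob_space_axioms]) auto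
  have component: "measure_pmf.expectation ?P (\<lambda>\<xi>. z ^ of_bool (\<xi> j)) = 1 - p j + p j * z"
    if j: "j \<in> {1..n}" for j
  proof -
    have "measure_pmf.expectation ?P (\<lambda>\<xi>. z ^ of_bool (\<xi> j))
        = measure_pmf.expectation (map_pmf (\<lambda>\<xi>. \<xi> j) ?P) (\<lambda>b. z ^ of_bool b)"
      by simp
    also have "map_pmf (\<lambda>\<xi>. \<xi> j) ?P = bernoulli_pmf (p j)"
      using j by (subst Pi_pmf_component) auto
    also have "measure_pmf.expectation (bernoulli_pmf (p j)) (\<lambda>b. z ^ of_bool b)
        = (\<Sum>b\<in>UNIV. pmf (bernoulli_pmf (p j)) b *\<^sub>R z ^ of_bool b)"
      by (rule integral_measure_pmf) auto
    also have "\<dots> = 1 - p j + p j * z"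
      using p[OF j] by (simp add: UNIV_bool scaleR_conv_of_real)
    finally show ?thesis .
  qed
  have "measure_pmf.expectation (poisson_binomial_pmf n p) (\<lambda>k. z ^ k)
      = measure_pmf.expectation ?P (\<lambda>\<xi>. \<Prod>j = 1..n. z ^ of_bool (\<xi> j))"
    by (simp only: poisson_binomial_pmf_def integral_map_pmf power_sum)
  also have "\<dots> = (\<Prod>j = 1..n. measure_pmf.expectation ?P (\<lambda>\<xi>. z ^ of_bool (\<xi> j)))"
  proof (rule prob_space.indep_vars_lebesgue_integral[OF measure_pmf.prob_space_axioms _ indep])
    fix j
    show "integrable ?P (\<lambda>\<xi>. z ^ of_bool (\<xi> j))"
      by (intro measure_pmf.integrable_const_bound[where B = "max 1 (cmod z)"]) auto
  qed simp
  also have "\<dots> = (\<Prod>j = 1..n. 1 - p j + p j * z)"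
    by (intro prod.cong refl component)
  finally show ?thesis
    by simp
qed

lemma borel_measurable_random_sum:
  assumes N: "N \<in> measurable M (count_space UNIV)"
    and X: "\<And>j. j \<ge> 1 \<Longrightarrow> X j \<in> borel_measurable M"
  shows "random_sum X N \<in> borel_measurable M"
proof -
  have "(\<lambda>\<omega>. \<Sum>j = 1..k. X j \<omega>) \<in> borel_measurable M" for k
    using X by (intro borel_measurable_sum) auto
  then show ?thesis
    unfolding random_sum_def[abs_def] by (rule measurable_compose_countable[OF _ N])
qed

text \<open>Split according to the value \<open>k\<close> of \<open>N\<close>. Joint independence
  turns each piece into the probability of \<open>k\<close> times \<open>\<phi> ^ k\<close>, and the
  sum is the generating function of \<open>N\<close> at \<open>\<phi>\<close>.\<close>

lemma (in prob_space) char_scaled_random_sum: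
  fixes p :: "nat \<Rightarrow> real" and s :: real
  assumes N [measurable]: "N \<in> measurable M (count_space UNIV)"
    and N_distr: "distr M (count_space UNIV) N = measure_pmf (poisson_binomial_pmf n p)"
    and p: "\<And>j. j \<in> {1..n} \<Longrightarrow> p j \<in> {0..1}"
    and X: "\<And>j. j \<ge> 1 \<Longrightarrow> random_variable borel (X j)"
    and X_ident: "\<And>j. j \<ge> 1 \<Longrightarrow> distr M borel (X j) = distr M borel (X 1)"
    and indep: "jointly_indep M N X"
  shows "char (distr M borel (\<lambda>\<omega>. s * random_sum X N \<omega>)) t
    = (\<Prod>j = 1..n. 1 - p j + p j * char (distr M borel (\<lambda>\<omega>. s * X 1 \<omega>)) t)"
proof -
  let ?V = "\<lambda>j. if j = 0 then (\<lambda>\<omega>. real (N \<omega>)) else X j"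
  \<comment> \<open>Index 0 carries the indicator of \<open>N = k\<close>, so the product over
    \<open>{0..k}\<close> is the exponential of the k-th partial sum restricted to that
    event.\<close>
  let ?g = "\<lambda>k j x. if j = (0::nat) then indicator {real k} x else iexp (t * (s * x))"
  define \<phi> where "\<phi> = char (distr M borel (\<lambda>\<omega>. s * X 1 \<omega>)) t"
  have V [measurable]: "random_variable borel (?V j)" for j
    using X[of j] by (cases "j = 0") auto
  have g [measurable]: "?g k j \<in> borel_measurable borel" for k j
    by (cases "j = 0") auto
  have X_char: "(CLINT \<omega>|M. iexp (t * (s * X j \<omega>))) = \<phi>" if "j \<ge> 1" for j
  proof -
    have "(CLINT \<omega>|M. iexp (t * (s * X j \<omega>))) = (CLINT x|distr M borel (X j). iexp (t * (s * x)))"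
      using X[OF that] by (simp add: integral_distr)
    also have "\<dots> = (CLINT \<omega>|M. iexp (t * (s * X 1 \<omega>)))"
      using X[of 1] by (simp add: X_ident[OF that] integral_distr)
    also have "\<dots> = \<phi>"
      using X[of 1] by (simp add: \<phi>_def char_def integral_distr)
    finally show ?thesis .
  qed
  have bounded: "cmod (?g k j x) \<le> 1" for k j x
    by (simp add: indicator_def)
  have g_int: "integrable M (\<lambda>\<omega>. ?g k j (?V j \<omega>))" for k j
    by (rule integrable_const_bound[where B = 1])
       (rule AE_I2[OF bounded], rule measurable_compose[OF V g])
  have term_indep: "indep_vars (\<lambda>_. borel) (\<lambda>j \<omega>. ?g k j (?V j \<omega>)) {0..k}" for k
    using indep_vars_subset[OF indep[unfolded jointly_indep_def] subset_UNIV]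
    by (rule indep_vars_compose2) (rule g)
  have term_int: "integrable M (\<lambda>\<omega>. \<Prod>j\<in>{0..k}. ?g k j (?V j \<omega>))" for k
    by (rule indep_vars_integrable[OF _ term_indep g_int]) simp
  have term_eq: "(CLINT \<omega>|M. (\<Prod>j\<in>{0..k}. ?g k j (?V j \<omega>))) = pmf (poisson_binomial_pmf n p) k * \<phi> ^ k" for k
  proof -
    have "(CLINT \<omega>|M. (\<Prod>j\<in>{0..k}. ?g k j (?V j \<omega>))) = (\<Prod>j\<in>{0..k}. CLINT \<omega>|M. ?g k j (?V j \<omega>))"
      by (rule indep_vars_lebesgue_integral[OF _ term_indep g_int]) simp
    also have "\<dots> = (CLINT \<omega>|M. indicator {real k} (real (N \<omega>))) * (\<Prod>j = 1..k. CLINT \<omega>|M. iexp (t * (s * X j \<omega>)))"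
      by (simp add: prod.atLeast_Suc_atMost)
    also have "(\<Prod>j = 1..k. CLINT \<omega>|M. iexp (t * (s * X j \<omega>))) = (\<Prod>j = 1..k. \<phi>)"
      by (intro prod.cong refl X_char) simp
    also have "(\<Prod>j = 1..k. \<phi>) = \<phi> ^ k"
      by simp
    also have "(CLINT \<omega>|M. indicator {real k} (real (N \<omega>))) = pmf (poisson_binomial_pmf n p) k"
    proof -
      have "(CLINT \<omega>|M. indicator {real k} (real (N \<omega>))) = (CLINT i|distr M (count_space UNIV) N. indicator {k} i)"
        by (subst integral_distr) (auto intro!: Bochner_Integration.integral_cong simp: indicator_def)
      also have "\<dots> = pmf (poisson_binomial_pmf n p) k"
        unfolding N_distr
        by (subst integral_measure_pmf[of "{k}"]) (auto simp: scaleR_conv_of_real split: split_indicator_asm)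
      finally show ?thesis .
    qed
    finally show ?thesis .
  qed
  \<comment> \<open>Only the law of \<open>N\<close> is prescribed, so the bound by
    \<open>n\<close>, and with it the finite decomposition, holds almost everywhere.\<close>
  have "AE \<omega> in M. N \<omega> \<le> n"
  proof (rule AE_distrD[OF N])
    show "AE i in distr M (count_space UNIV) N. i \<le> n"
      unfolding N_distr AE_measure_pmf_iff using set_poisson_binomial_pmf[of n p] by auto
  qed
  then have AE_eq: "AE \<omega> in M. iexp (t * (s * random_sum X N \<omega>)) = (\<Sum>k\<le>n. \<Prod>j\<in>{0..k}. ?g k j (?V j \<omega>))"
  proof eventually_elim
    case (elim \<omega>)
    have "(\<Prod>j\<in>{0..k}. ?g k j (?V j \<omega>)) = (if k = N \<omega> then iexp (t * (s * random_sum X N \<omega>)) else 0)" for k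
    proof -
      have "(\<Prod>j\<in>{0..k}. ?g k j (?V j \<omega>))
          = indicator {real k} (real (N \<omega>)) * (\<Prod>j = 1..k. iexp (t * (s * X j \<omega>)))"
        by (simp add: prod.atLeast_Suc_atMost)
      also have "(\<Prod>j = 1..k. iexp (t * (s * X j \<omega>))) = iexp (t * (s * (\<Sum>j = 1..k. X j \<omega>)))"
        by (simp add: exp_sum[symmetric] sum_distrib_left)
      finally show ?thesis
        by (auto simp: indicator_def random_sum_def)
    qed
    then show ?case
      using elim by simp
  qed
  have [measurable]: "random_variable borel (random_sum X N)"
    using N X by (rule borel_measurable_random_sum)
  have "char (distr M borel (\<lambda>\<omega>. s * random_sum X N \<omega>)) t = (CLINT \<omega>|M. iexp (t * (s * random_sum X N \<omega>)))"
    by (simp add: char_def integral_distr)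
  also have "\<dots> = (CLINT \<omega>|M. (\<Sum>k\<le>n. \<Prod>j\<in>{0..k}. ?g k j (?V j \<omega>)))"
    using AE_eq by (intro integral_cong_AE) (auto intro!: borel_measurable_sum borel_measurable_integrable[OF term_int])
  also have "\<dots> = (\<Sum>k\<le>n. pmf (poisson_binomial_pmf n p) k * \<phi> ^ k)"
    by (subst Bochner_Integration.integral_sum) (rule term_int, simp only: term_eq)
  also have "\<dots> = measure_pmf.expectation (poisson_binomial_pmf n p) (\<lambda>k. \<phi> ^ k)"
    using set_poisson_binomial_pmf[of n p]
    by (subst integral_measure_pmf[of "{..n}"]) (auto simp: scaleR_conv_of_real)
  also have "\<dots> = (\<Prod>j = 1..n. 1 - p j + p j * \<phi>)"
    using p by (rule expectation_power_poisson_binomial)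
  finally show ?thesis
    by (simp only: \<phi>_def)
qed

section \<open>Comparison with the normal distribution\<close>

lemma measure_std_normal_eq:
  assumes [measurable]: "A \<in> sets borel"
  shows "measure std_normal_distribution A = (LINT x|lborel. std_normal_density x * indicator A x)"
proof -
  have "measure std_normal_distribution A = (LINT x|std_normal_distribution. indicator A x)"
    by simp
  also have "\<dots> = (LINT x|lborel. std_normal_density x * indicator A x)"
    by (subst integral_density) (auto simp: normal_density_nonneg)
  finally show ?thesis .
qed

lemma integrable_std_normal_indicator:
  assumes "A \<in> sets borel"
  shows "integrable lborel (\<lambda>x. std_normal_density x * indicator A x)"
  using assms by (intro integrable_real_mult_indicator integrable_normal_density) auto

lemma std_normal_interval_le:
  assumes "c \<le> d"
  shows "measure std_normal_distribution {c..d} \<le> (d - c) / sqrt (2 * pi)"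
proof -
  have "measure std_normal_distribution {c..d} = (LINT x|lborel. std_normal_density x * indicator {c..d} x)"
    by (rule measure_std_normal_eq) simp
  also have "\<dots> \<le> (LINT x|lborel. 1 / sqrt (2 * pi) * indicator {c..d} x)"
    using assms
    by (intro integral_mono integrable_std_normal_indicator mult_right_mono)
       (auto simp: std_normal_density_def divide_right_mono)
  also have "\<dots> = (d - c) / sqrt (2 * pi)"
    using assms by simp
  finally show ?thesis .
qed

text \<open>Bathtub argument: the density is at least its value at \<open>z / 2\<close> inside the
  central interval and at most that value outside, so moving mass of equal length out of the centre
  can only lose probability.\<close>

lemma std_normal_interval_le_central:
  assumes "0 \<le> z"
  shows "measure std_normal_distribution {x..x + z} \<le> measure std_normal_distribution {- (z / 2)..z / 2}"
proof -
  let ?f = std_normal_density and ?I = "indicator {x..x + z} :: real \<Rightarrow> real"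
    and ?J = "indicator {- (z / 2)..z / 2} :: real \<Rightarrow> real"
  have int: "integrable lborel (\<lambda>y. ?f y * indicator {a..b} y)" "integrable lborel (indicator {a..b} :: real \<Rightarrow> real)" for a b
    by (auto intro!: integrable_std_normal_indicator integrable_real_indicator simp: emeasure_lborel_Icc_eq)
  \<comment> \<open>The subtracted multiple of the difference of lengths vanishes; it recentres the
    density at the level \<open>?f (z / 2)\<close>, so that the combined integrand has a
    sign.\<close>
  have "measure std_normal_distribution {x..x + z} - measure std_normal_distribution {- (z / 2)..z / 2}
      = (LINT y|lborel. ?f y * ?I y) - (LINT y|lborel. ?f y * ?J y)
        - ?f (z / 2) * ((LINT y|lborel. ?I y) - (LINT y|lborel. ?J y))"
    using assms by (simp add: measure_std_normal_eq)
  also have "\<dots> = (LINT y|lborel. (?I y - ?J y) * (?f y - ?f (z / 2)))"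
    using int by (simp add: algebra_simps)
  also have "\<dots> \<le> (LINT y|(lborel :: real measure). 0)"
  proof (rule integral_mono)
    fix y
    have far: "?f y \<le> ?f (z / 2)" if "z / 2 \<le> \<bar>y\<bar>"
      using power_mono[OF that, of 2] assms by (simp add: std_normal_density_def divide_right_mono)
    have near: "?f (z / 2) \<le> ?f y" if "\<bar>y\<bar> \<le> z / 2"
      using power_mono[OF that, of 2] assms by (simp add: std_normal_density_def divide_right_mono)
    show "(?I y - ?J y) * (?f y - ?f (z / 2)) \<le> 0"
    proof (cases "\<bar>y\<bar> \<le> z / 2")
      case True
      then have "?J y = 1" "?I y \<le> 1"
        by (auto simp: indicator_def abs_le_iff)
      then show ?thesis
        using near[OF True] by (intro mult_nonpos_nonneg) auto
    next
      case False
      then have "?J y = 0"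
        by (auto simp: indicator_def)
      then show ?thesis
        using far False by (intro mult_nonneg_nonpos) auto
    qed
  qed (use int in \<open>auto simp: algebra_simps\<close>)
  finally show ?thesis
    by simp
qed

text \<open>By symmetry the left tail below \<open>- u\<close> has the mass of the right tail above
  \<open>u\<close>. Taking that tail open leaves the closed interval as its complement in
  \<open>{..u}\<close>.\<close>

lemma folded_normal_cdf_eq:
  assumes "0 \<le> u"
  shows "folded_normal_cdf u = measure std_normal_distribution {- u..u}"
proof -
  interpret real_distribution std_normal_distribution
    by (rule real_dist_normal_dist)
  have "prob {..< - u} = (LINT x|lborel. std_normal_density x * indicator {..< - u} x)"
    by (rule measure_std_normal_eq) simp
  also have "\<dots> = (LINT x|lborel. std_normal_density x * indicator {u<..} x)"
    by (subst lborel_integral_real_affine[where c = "-1" and t = 0])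
       (auto simp: indicator_def std_normal_density_def intro!: Bochner_Integration.integral_cong)
  also have "\<dots> = prob {u<..}"
    by (rule measure_std_normal_eq[symmetric]) simp
  also have "{u<..} = space std_normal_distribution - {..u}"
    by auto
  also have "prob \<dots> = 1 - prob {..u}"
    by (rule prob_compl) simp
  finally have "prob {..< - u} = 1 - prob {..u}" .
  moreover have "{..u} = {..< - u} \<union> {- u..u}"
    using assms by auto
  then have "prob {..u} = prob ({..< - u} \<union> {- u..u})"
    by simp
  then have "prob {..u} = prob {..< - u} + prob {- u..u}"
    by (subst (asm) finite_measure_Union) auto
  ultimately show ?thesis
    using assms by (simp add: folded_normal_cdf_def cdf_def)
qed

section \<open>Rescaling and the final estimate\<close>

lemma (in real_distribution) measure_scaled_interval:
  assumes "0 < T"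
  shows "measure (distr M borel (\<lambda>x. T * x)) {T * a..T * b} = prob {a..b}"
proof -
  have "(\<lambda>x. T * x) -` {T * a..T * b} \<inter> space M = {a..b}"
    using assms by auto
  then show ?thesis
    by (subst measure_distr) auto
qed

lemma (in real_distribution) char_scaled: "char (distr M borel (\<lambda>x. T * x)) t = char M (T * t)"
  by (simp add: char_def integral_distr mult_ac)

text \<open>Scaling both laws by \<open>T = 1 / L\<close> moves the frequency range [0, 1/L] to the
  [0, 1] of the kernel and lowers the normal density bound to \<open>L / sqrt (2 * pi)\<close>. Both
  smoothing errors are then linear in \<open>L\<close>.\<close>

lemma interval_normal_approx:
  assumes \<mu>: "real_distribution \<mu>" and "0 < L"
    and char: "\<And>t. 0 \<le> t \<Longrightarrow> t \<le> 1 / L \<Longrightarrow> cmod (char \<mu> t - complex_of_real (exp (- t\<^sup>2 / 2))) \<le> L * t\<^sup>2 * exp (- t\<^sup>2 / 4)"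
  shows "\<bar>measure \<mu> {a..b} - measure std_normal_distribution {a..b}\<bar> \<le> 7.4508 * L"
proof -
  interpret \<mu>: real_distribution \<mu> by fact
  interpret \<nu>: real_distribution std_normal_distribution by (rule real_dist_normal_dist)
  define T where "T = 1 / L"
  let ?\<mu> = "distr \<mu> borel (\<lambda>x. T * x)" and ?\<nu> = "distr std_normal_distribution borel (\<lambda>x. T * x)"
  \<comment> \<open>The assumed bound at frequency \<open>T * t\<close>, divided by
    \<open>t\<close>. What remains has an elementary primitive, and its integral is at most
    \<open>2 * L\<close>.\<close>
  let ?h = "\<lambda>t. L * (T\<^sup>2 * t * exp (- (T * t)\<^sup>2 / 4))"
  have T: "0 < T" and LT: "L * T = 1"
    using \<open>0 < L\<close> by (auto simp: T_def)
  have "(LINT t:{0..1}|lborel. ?h t) = L * (- 2 * exp (- (T * 1)\<^sup>2 / 4)) - L * (- 2 * exp (- (T * 0)\<^sup>2 / 4))"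
    unfolding set_lebesgue_integral_def
    by (rule integral_FTC_atLeastAtMost[where F = "\<lambda>t. L * (- 2 * exp (- (T * t)\<^sup>2 / 4))"])
       (auto intro!: derivative_eq_intros continuous_intros
          simp: has_real_derivative_iff_has_vector_derivative[symmetric] power2_eq_square)
  then have h: "(LINT t:{0..1}|lborel. ?h t) \<le> 2 * L"
    using \<open>0 < L\<close> by simp
  have "\<bar>measure ?\<mu> {T * a..T * b} - measure ?\<nu> {T * a..T * b}\<bar>
      \<le> (4 * pi * (4 * L / pi) + 54 * (L / sqrt (2 * pi))) / (18 - 4 * pi)"
  proof (rule fejer_smoothing_inequality)
    show dist: "real_distribution ?\<mu>" "real_distribution ?\<nu>"
      by (simp_all add: \<mu>.real_distribution_distr \<nu>.real_distribution_distr)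
    fix c d :: real assume "c \<le> d"
    have "measure ?\<nu> {c..d} = measure std_normal_distribution {L * c..L * d}"
      using \<nu>.measure_scaled_interval[OF T, of "L * c" "L * d"] LT by (simp add: mult.assoc[symmetric] mult.commute[of T])
    also have "\<dots> \<le> L / sqrt (2 * pi) * (d - c)"
      using std_normal_interval_le[of "L * c" "L * d"] \<open>c \<le> d\<close> \<open>0 < L\<close> by (simp add: right_diff_distrib diff_divide_distrib)
    finally show "measure ?\<nu> {c..d} \<le> L / sqrt (2 * pi) * (d - c)" .
    have "\<bar>LINT v|lborel. fejer v * (measure ?\<mu> {c - v..d - v} - measure ?\<nu> {c - v..d - v})\<bar>
        \<le> 2 / pi * (LINT t:{0..1}|lborel. ?h t)"
    proof (rule fejer_smoothed_diff_le[OF dist \<open>c \<le> d\<close>])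
      show "set_integrable lborel {0..1} ?h"
        by (intro borel_integrable_atLeastAtMost' continuous_intros) auto
      fix t :: real assume t: "0 < t" "t \<le> 1"
      have "char ?\<mu> t - char ?\<nu> t = char \<mu> (T * t) - complex_of_real (exp (- (T * t)\<^sup>2 / 2))"
        by (simp only: \<mu>.char_scaled \<nu>.char_scaled char_std_normal_distribution)
      also have "cmod \<dots> \<le> L * (T * t)\<^sup>2 * exp (- (T * t)\<^sup>2 / 4)"
        using t T by (intro char) (auto simp: T_def[symmetric] mult_left_le)
      also have "\<dots> = t * ?h t"
        by (simp add: power2_eq_square mult_ac)
      finally show "cmod (char ?\<mu> t - char ?\<nu> t) \<le> t * ?h t" .
    qed
    also have "\<dots> \<le> 2 / pi * (2 * L)"
      using h by (intro mult_left_mono) auto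
    finally show "\<bar>LINT v|lborel. fejer v * (measure ?\<mu> {c - v..d - v} - measure ?\<nu> {c - v..d - v})\<bar>
        \<le> 4 * L / pi"
      by simp
  qed (use \<open>0 < L\<close> in auto)
  also have "\<dots> = (16 + 54 / sqrt (2 * pi)) / (18 - 4 * pi) * L"
    by (simp add: algebra_simps add_divide_distrib)
  also have "\<dots> \<le> 7.4508 * L"
  \<comment> \<open>The constant is about 6.91, so coarse bounds for \<open>pi\<close>
    suffice.\<close>
  proof (rule mult_right_mono)
    have pi: "3.14 \<le> pi" "pi \<le> 3.142"
      using pi_approx by simp_all
    have "2.5 \<le> sqrt (2 * pi)"
      using pi by (intro real_le_rsqrt) (simp add: power2_eq_square)
    then have "54 / sqrt (2 * pi) \<le> 54 / 2.5"
      by (intro divide_left_mono) auto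
    moreover have "7.4508 * (18 - 4 * 3.142) \<le> 7.4508 * (18 - 4 * pi)"
      using pi by simp
    ultimately have "16 + 54 / sqrt (2 * pi) \<le> 7.4508 * (18 - 4 * pi)"
      by simp
    then show "(16 + 54 / sqrt (2 * pi)) / (18 - 4 * pi) \<le> 7.4508"
      using pi_less_4 by (simp add: pos_divide_le_eq)
  qed (use \<open>0 < L\<close> in simp)
  finally show ?thesis
    by (simp add: \<mu>.measure_scaled_interval \<nu>.measure_scaled_interval T)
qed

theorem theorem3:
  fixes M :: "'a measure"
    and X :: "nat \<Rightarrow> 'a \<Rightarrow> real"
    and \<sigma> :: real
    and p :: "nat \<Rightarrow> real"
    and n :: nat
    and N :: "'a \<Rightarrow> nat"
    and \<theta> :: real
  assumes M: "prob_space M"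
    and X_measurable: "\<And>j. j \<ge> 1 \<Longrightarrow> X j \<in> borel_measurable M"
    and X_ident: "\<And>j. j \<ge> 1 \<Longrightarrow> distr M borel (X j) = distr M borel (X 1)"
    and X_square_integrable: "integrable M (\<lambda>\<omega>. (X 1 \<omega>)\<^sup>2)"
    and X_mean: "integral\<^sup>L M (X 1) = 0"
    and X_second_moment: "integral\<^sup>L M (\<lambda>\<omega>. (X 1 \<omega>)\<^sup>2) = \<sigma>\<^sup>2"
    and \<sigma>_pos: "\<sigma> > 0"
    and p_range: "\<And>j. j \<ge> 1 \<Longrightarrow> p j \<in> {0<..1}"
    and n: "n \<ge> 1"
    and N_measurable: "N \<in> measurable M (count_space UNIV)"
    and N_distr: "distr M (count_space UNIV) N = measure_pmf (poisson_binomial_pmf n p)"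
    and indep: "jointly_indep M N X"
  defines "\<theta> \<equiv> (\<Sum>j = 1..n. p j)"
  shows "(SUP z\<in>{0..}. \<bar>concentration_function M (random_sum X N) z
                         - folded_normal_cdf (z / (2 * \<sigma> * sqrt \<theta>))\<bar>)
         \<le> 7.4508 / \<sigma>\<^sup>2 *
             integral\<^sup>L M (\<lambda>\<omega>. (X 1 \<omega>)\<^sup>2 * min 1 (\<bar>X 1 \<omega>\<bar> / (\<sigma> * sqrt \<theta>)))"
proof -
  interpret prob_space M by fact
  have [measurable]: "random_variable borel (X 1)"
    by (rule X_measurable) simp
  have S [measurable]: "random_variable borel (random_sum X N)"
    using N_measurable X_measurable by (rule borel_measurable_random_sum)
  have \<theta>_pos: "0 < \<theta>"
    unfolding \<theta>_def using p_range n by (intro sum_pos) auto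
  \<comment> \<open>\<open>s\<close> normalises the random sum to unit variance, and
    \<open>Y\<close> is one normalised summand, of variance \<open>1 / \<theta>\<close>.
    \<open>L\<close> is the ratio of the truncated to the plain second moment of
    \<open>Y\<close>.\<close>
  define s where "s = 1 / (\<sigma> * sqrt \<theta>)"
  define L where "L = expectation (\<lambda>\<omega>. (X 1 \<omega>)\<^sup>2 * min 1 (\<bar>X 1 \<omega>\<bar> / (\<sigma> * sqrt \<theta>))) / \<sigma>\<^sup>2"
  define Y where "Y \<omega> = s * X 1 \<omega>" for \<omega>
  have s_pos: "0 < s"
    using \<sigma>_pos \<theta>_pos by (simp add: s_def)
  have s2: "s\<^sup>2 = 1 / (\<sigma>\<^sup>2 * \<theta>)"
    using \<theta>_pos by (simp add: s_def power_divide power_mult_distrib)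
  have Y [measurable]: "random_variable borel Y"
    unfolding Y_def[abs_def] by measurable
  have Y_int: "integrable M (\<lambda>\<omega>. (Y \<omega>)\<^sup>2)"
    using X_square_integrable by (simp add: Y_def power_mult_distrib)
  have Y_mean: "expectation Y = 0"
    using X_mean by (simp add: Y_def[abs_def])
  have Y_second: "expectation (\<lambda>\<omega>. (Y \<omega>)\<^sup>2) = 1 / \<theta>"
    using X_second_moment \<sigma>_pos by (simp add: Y_def power_mult_distrib s2)
  have Y_trunc: "expectation (\<lambda>\<omega>. (Y \<omega>)\<^sup>2 * min 1 \<bar>Y \<omega>\<bar>) = L / \<theta>"
  proof -
    have "(Y \<omega>)\<^sup>2 * min 1 \<bar>Y \<omega>\<bar> = s\<^sup>2 * ((X 1 \<omega>)\<^sup>2 * min 1 (\<bar>X 1 \<omega>\<bar> / (\<sigma> * sqrt \<theta>)))" for \<omega>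
      using \<sigma>_pos \<theta>_pos by (simp add: Y_def s_def abs_mult power_mult_distrib power_divide)
    then show ?thesis
      by (simp add: L_def s2)
  qed
  have L_nonneg: "0 \<le> L"
    using \<sigma>_pos \<theta>_pos by (auto simp: L_def intro!: divide_nonneg_nonneg Bochner_Integration.integral_nonneg)
  let ?Q = "concentration_function M (random_sum X N)"
  let ?P = "\<lambda>x z. prob {\<omega> \<in> space M. x \<le> random_sum X N \<omega> \<and> random_sum X N \<omega> \<le> x + z}"
  have Q_bdd: "bdd_above (range (\<lambda>x. ?P x z))" for z
    by (intro bdd_aboveI[where M = 1]) auto
  interpret Z: real_distribution std_normal_distribution
    by (rule real_dist_normal_dist)
  have folded: "folded_normal_cdf (z / (2 * \<sigma> * sqrt \<theta>)) = Z.prob {- (s * z / 2)..s * z / 2}" if "0 \<le> z" for z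
  proof -
    have eq: "z / (2 * \<sigma> * sqrt \<theta>) = s * z / 2"
      by (simp add: s_def)
    show ?thesis
      unfolding eq using folded_normal_cdf_eq[of "s * z / 2"] that s_pos by simp
  qed
  have "\<bar>?Q z - folded_normal_cdf (z / (2 * \<sigma> * sqrt \<theta>))\<bar> \<le> 7.4508 * L" if z: "0 \<le> z" for z
  proof (cases "L \<le> 1 / 7")
    case False
    \<comment> \<open>Both quantities lie in [0, 1], and \<open>7.4508 / 7\<close> exceeds
      1.\<close>
    have "?Q z \<le> 1"
      unfolding concentration_function_def by (intro cSUP_least) auto
    moreover have "0 \<le> ?Q z"
      unfolding concentration_function_def using Q_bdd by (intro cSUP_upper2[where x = 0]) auto
    moreover have "0 \<le> Z.prob A" "Z.prob A \<le> 1" for A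
      by auto
    ultimately have "\<bar>?Q z - folded_normal_cdf (z / (2 * \<sigma> * sqrt \<theta>))\<bar> \<le> 1"
      unfolding folded[OF z] by (smt (verit))
    then show ?thesis
      using False by simp
  next
    case True
    define W where "W = distr M borel (\<lambda>\<omega>. s * random_sum X N \<omega>)"
    have W: "real_distribution W"
      unfolding W_def by (rule real_distribution_distr) simp
    have "1 / sqrt \<theta> \<le> L"
      using sd_le_truncated_ratio[OF Y Y_int, of "1 / sqrt \<theta>" L] \<theta>_pos True Y_second Y_trunc
      by (simp add: power_divide)
    moreover have "0 < 1 / sqrt \<theta>"
      using \<theta>_pos by simp
    ultimately have L_pos: "0 < L"
      by linarith
    have char_W: "char W t = (\<Prod>j = 1..n. 1 - p j + p j * char (distr M borel Y) t)" for t
      unfolding W_def Y_def[abs_def]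
    proof (rule char_scaled_random_sum[OF N_measurable N_distr _ X_measurable X_ident indep])
      show "p j \<in> {0..1}" if "j \<in> {1..n}" for j
        using p_range[of j] that by auto
    qed
    have approx: "\<bar>measure W {a..b} - Z.prob {a..b}\<bar> \<le> 7.4508 * L" for a b
    proof (rule interval_normal_approx[OF W L_pos])
      fix t assume t: "0 \<le> t" "t \<le> 1 / L"
      show "cmod (char W t - complex_of_real (exp (- t\<^sup>2 / 2))) \<le> L * t\<^sup>2 * exp (- t\<^sup>2 / 4)"
        unfolding char_W
      proof (rule char_product_normal_approx[OF Y Y_int Y_mean Y_second Y_trunc finite_atLeastAtMost
            _ _ _ \<theta>_pos L_pos True t])
        show "0 \<le> p j" "p j \<le> 1" if "j \<in> {1..n}" for j
          using p_range[of j] that by auto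
        show "\<theta> = (\<Sum>j = 1..n. p j)"
          by (simp only: \<theta>_def)
      qed
    qed
    have P_eq: "?P x z = measure W {s * x..s * x + s * z}" for x
    proof -
      have "{\<omega> \<in> space M. x \<le> random_sum X N \<omega> \<and> random_sum X N \<omega> \<le> x + z}
          = (\<lambda>\<omega>. s * random_sum X N \<omega>) -` {s * x..s * x + s * z} \<inter> space M"
        using s_pos by (auto simp flip: distrib_left)
      then show ?thesis
        by (simp add: W_def measure_distr)
    qed
    have sz: "0 \<le> s * z"
      using z s_pos by simp
    \<comment> \<open>Every window of \<open>W\<close> is close to the corresponding normal window,
      which is dominated by the central one.\<close>
    have "?Q z \<le> Z.prob {- (s * z / 2)..s * z / 2} + 7.4508 * L"
      unfolding concentration_function_def
    proof (rule cSUP_least)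
      fix x
      show "?P x z \<le> Z.prob {- (s * z / 2)..s * z / 2} + 7.4508 * L"
        using approx[of "s * x" "s * x + s * z"] std_normal_interval_le_central[OF sz, of "s * x"]
        unfolding P_eq by linarith
    qed simp
    moreover have "Z.prob {- (s * z / 2)..s * z / 2} - 7.4508 * L \<le> ?Q z"
    proof -
      \<comment> \<open>The centred window is the witness in the supremum for the lower
        bound.\<close>
      have "?P (- (z / 2)) z = measure W {- (s * z / 2)..s * z / 2}"
        unfolding P_eq by simp
      then have "Z.prob {- (s * z / 2)..s * z / 2} - 7.4508 * L \<le> ?P (- (z / 2)) z"
        using approx[of "- (s * z / 2)" "s * z / 2"] by linarith
      also have "\<dots> \<le> ?Q z"
        unfolding concentration_function_def by (rule cSUP_upper[OF UNIV_I Q_bdd])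
      finally show ?thesis .
    qed
    ultimately show ?thesis
      unfolding folded[OF z] by linarith
  qed
  then have "(SUP z\<in>{0..}. \<bar>?Q z - folded_normal_cdf (z / (2 * \<sigma> * sqrt \<theta>))\<bar>) \<le> 7.4508 * L"
    by (intro cSUP_least) auto
  then show ?thesis
    by (simp add: L_def)
qed

end
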